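(* Let $\epsilon\in(0,1/6)$ and $p\in(0,1]$. For every stochastic Generalized Assignment Problem instance, given oracle access to the values $M_j=\mathbb E_R[\mathrm{OPT}_j]$ for every knapsack $j\in[m]$, the Bucket-Based GAP Sparsifier described in the context, run with accuracy parameter $\epsilon$ and these $M_j$, is a $(1-6\epsilon)$-approximate sparsifier with sparsification degree $$O\!\left(\frac{\log^2(1/\epsilon)}{\epsilon^3 p}\right).$$
   Context: Generalized Assignment Problem (GAP): $m$ knapsacks, knapsack $j$ with capacity $C_j$, and a finite set $E$ of items; assigning item $i$ to knapsack $j$ yields value $v_{ij}\ge0$ and uses weight $w_{ij}>0$. An assignment is a set $\mathbf S\subseteq E\times[m]$ in which each item appears at most once and $\sum_{(i,j)\in\mathbf S}w_{ij}\le C_j$ for every $j$; its value is $\sum_{(i,j)\in\mathbf S}v_{ij}$. An item set $S\subseteq E$ is feasible ($S\in\mathcal F$) iff some assignment uses exactly the items of $S$, and $f(S)$ is the maximum value of an assignment using only items of $S$. It is assumed that every item $i$ fits in some knapsack ($w_{ij}\le C_j$ for some $j$). Stochastic version: a random active set $R\subseteq E$ contains each item independently with probability $p$; $\mathrm{OPT}(R)$ is the optimal value on $R$. Fix a deterministic tie-breaking rule choosing one optimal assignment $\mathbf{OPT}(R)$ for each $R$, and let $\mathrm{OPT}_j(R)$ be the total value of the pairs of $\mathbf{OPT}(R)$ in knapsack $j$, so $\mathrm{OPT}(R)=\sum_j\mathrm{OPT}_j(R)$. Sparsifier: let $\mathcal P_{\mathcal F}=\mathrm{conv}\{\mathbf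 1_S:S\in\mathcal F\}\subseteq\mathbb R^E$. An algorithm that outputs a (possibly randomized) query set $Q\subseteq E$, chosen before $R$ is observed, is an $\alpha$-approximate sparsifier with degree $d\ge1$ if (1) for every realization of $Q$, $\frac1d\mathbf 1_Q\in\mathcal P_{\mathcal F}$, and (2) $\mathbb E_{R,Q}[\max\{f(S):S\in\mathcal F,S\subseteq Q\cap R\}]\ge\alpha\,\mathbb E_R[\mathrm{OPT}]$. Bucket-Based GAP Sparsifier with parameter $\epsilon$ and values $M_j$: let $\tau(x)=1+\ln(1/x)+\sqrt{\ln^2(1/x)+2\ln(1/x)}$ and $K=\lceil\frac2{\epsilon^2}\log(\frac1{\epsilon^3})\rceil$. For each $j$, the pair $(i,j)$ has bucket index $\beta(i,j)=0$ if $v_{ij}\le\epsilon^2M_j$; $\beta(i,j)=k$ for $1\le k\le K$ if $v_{ij}\in(\epsilon^2(1+\epsilon^2)^{k-1}M_j,\ \epsilon^2(1+\epsilon^2)^kM_j]$; and $\beta(i,j)=K+1$ if $v_{ij}>\epsilon^2(1+\epsilon^2)^KM_j$. Start with $Q=\emptyset$, set $\alpha=1/\epsilon$, and for rounds $t=1,\dots,\alpha-1$: set a budget $b(j,k)=\frac{\tau(\epsilon^2)}{p}C_j$ for every $j\in[m]$ and $k\in\{0,\dots,K+1\}$; then, while there is a pair $(i,j)$ with $i\notin Q$, $\beta(i,j)\ge1$, $w_{ij}\le C_j$ and $b(j,\beta(i,j))>0$, choose such a pair minimizing $w_{ij}$, add $i$ to $Q$ and decrease $b(j,\beta(i,j))$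 by $w_{ij}$; then, while there is a pair $(i,j)$ with $i\notin Q$, $\beta(i,j)=0$, $w_{ij}\le C_j$ and $b(j,0)>0$, choose such a pair maximizing $v_{ij}/w_{ij}$, add $i$ to $Q$ and decrease $b(j,0)$ by $w_{ij}$. Output $Q$. *)

theory Defs
  imports "HOL-Analysis.Analysis"
begin

text \<open>Items form a finite carrier set E; knapsacks are indexed by j < m.
  v i j = value, w i j = weight of putting item i into knapsack j; C j = capacity.\<close>

definition gap_instance ::
  "'a set \<Rightarrow> nat \<Rightarrow> (nat \<Rightarrow> real) \<Rightarrow> ('a \<Rightarrow> nat \<Rightarrow> real) \<Rightarrow> ('a \<Rightarrow> nat \<Rightarrow> real) \<Rightarrow> bool" where
  "gap_instance E m C v w \<longleftrightarrow>
     finite E \<and>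
     (\<forall>j<m. 0 \<le> C j) \<and>
     (\<forall>i\<in>E. \<forall>j<m. 0 \<le> v i j \<and> 0 < w i j) \<and>
     (\<forall>i\<in>E. \<exists>j<m. w i j \<le> C j)"

definition is_assignment ::
  "'a set \<Rightarrow> nat \<Rightarrow> (nat \<Rightarrow> real) \<Rightarrow> ('a \<Rightarrow> nat \<Rightarrow> real) \<Rightarrow> ('a \<times> nat) set \<Rightarrow> bool" where
  "is_assignment E m C w A \<longleftrightarrow>
     A \<subseteq> E \<times> {..<m} \<and>
     (\<forall>i j j'. (i, j) \<in> A \<longrightarrow> (i, j') \<in> A \<longrightarrow> j = j') \<and>
     (\<forall>j<m. (\<Sum>p\<in>{p\<in>A. snd p = j}. w (fst p) (snd p)) \<le> C j)"

definition assign_value :: "('a \<Rightarrow> nat \<Rightarrow> real) \<Rightarrow> ('a \<times> nat) set \<Rightarrow> real" where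
  "assign_value v A = (\<Sum>p\<in>A. v (fst p) (snd p))"

definition assign_value_in :: "('a \<Rightarrow> nat \<Rightarrow> real) \<Rightarrow> ('a \<times> nat) set \<Rightarrow> nat \<Rightarrow> real" where
  "assign_value_in v A j = (\<Sum>p\<in>{p\<in>A. snd p = j}. v (fst p) (snd p))"

definition gap_feasible ::
  "'a set \<Rightarrow> nat \<Rightarrow> (nat \<Rightarrow> real) \<Rightarrow> ('a \<Rightarrow> nat \<Rightarrow> real) \<Rightarrow> 'a set \<Rightarrow> bool" where
  "gap_feasible E m C w S \<longleftrightarrow> (\<exists>A. is_assignment E m C w A \<and> fst ` A = S)"

definition gap_f ::
  "'a set \<Rightarrow> nat \<Rightarrow> (nat \<Rightarrow> real) \<Rightarrow> ('a \<Rightarrow> nat \<Rightarrow> real) \<Rightarrow> ('a \<Rightarrow> nat \<Rightarrow> real) \<Rightarrow> 'a set \<Rightarrow> real" where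
  "gap_f E m C v w S =
     Max (assign_value v ` {A. is_assignment E m C w A \<and> fst ` A \<subseteq> S})"

text \<open>A deterministic tie-breaking rule: for every R \<subseteq> E an optimal assignment OPT(R)
  using only items of R.\<close>
definition opt_rule ::
  "'a set \<Rightarrow> nat \<Rightarrow> (nat \<Rightarrow> real) \<Rightarrow> ('a \<Rightarrow> nat \<Rightarrow> real) \<Rightarrow> ('a \<Rightarrow> nat \<Rightarrow> real)
     \<Rightarrow> ('a set \<Rightarrow> ('a \<times> nat) set) \<Rightarrow> bool" where
  "opt_rule E m C v w opt \<longleftrightarrow>
     (\<forall>R\<subseteq>E. is_assignment E m C w (opt R) \<and> fst ` opt R \<subseteq> R \<and>
              assign_value v (opt R) = gap_f E m C v w R)"

definition ER :: "'a set \<Rightarrow> real \<Rightarrow> ('a set \<Rightarrow> real) \<Rightarrow> real" where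
  "ER E p g = (\<Sum>R\<in>Pow E. p ^ card R * (1 - p) ^ card (E - R) * g R)"

text \<open>Membership in P_F = conv{1_S : S \<in> F} \<subseteq> R^E, written out as a convex combination
  of the (finitely many) indicator vectors of feasible sets.\<close>
definition in_PF ::
  "'a set \<Rightarrow> nat \<Rightarrow> (nat \<Rightarrow> real) \<Rightarrow> ('a \<Rightarrow> nat \<Rightarrow> real) \<Rightarrow> ('a \<Rightarrow> real) \<Rightarrow> bool" where
  "in_PF E m C w x \<longleftrightarrow>
     (\<exists>lam :: 'a set \<Rightarrow> real.
        (\<forall>S\<in>{S. S \<subseteq> E \<and> gap_feasible E m C w S}. 0 \<le> lam S) \<and>
        (\<Sum>S\<in>{S. S \<subseteq> E \<and> gap_feasible E m C w S}. lam S) = 1 \<and>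
        (\<forall>i\<in>E. x i = (\<Sum>S\<in>{S. S \<subseteq> E \<and> gap_feasible E m C w S}. lam S * indicator S i)))"

text \<open>An (output of an) algorithm with deterministic query set Q is an alpha-approximate
  sparsifier with degree d.\<close>
definition approx_sparsifier ::
  "'a set \<Rightarrow> nat \<Rightarrow> (nat \<Rightarrow> real) \<Rightarrow> ('a \<Rightarrow> nat \<Rightarrow> real) \<Rightarrow> ('a \<Rightarrow> nat \<Rightarrow> real) \<Rightarrow> real
     \<Rightarrow> real \<Rightarrow> real \<Rightarrow> 'a set \<Rightarrow> bool" where
  "approx_sparsifier E m C v w p \<alpha> d Q \<longleftrightarrow>
     Q \<subseteq> E \<and> 1 \<le> d \<and>
     in_PF E m C w (\<lambda>i. (1 / d) * indicator Q i) \<and>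
     ER E p (\<lambda>R. Max {gap_f E m C v w S | S. gap_feasible E m C w S \<and> S \<subseteq> Q \<inter> R})
       \<ge> \<alpha> * ER E p (\<lambda>R. gap_f E m C v w R)"

definition tau :: "real \<Rightarrow> real" where
  "tau x = 1 + ln (1 / x) + sqrt ((ln (1 / x))\<^sup>2 + 2 * ln (1 / x))"

definition bucketK :: "real \<Rightarrow> nat" where
  "bucketK \<epsilon> = nat \<lceil>(2 / \<epsilon>\<^sup>2) * ln (1 / \<epsilon> ^ 3)\<rceil>"

definition bucket :: "real \<Rightarrow> (nat \<Rightarrow> real) \<Rightarrow> ('a \<Rightarrow> nat \<Rightarrow> real) \<Rightarrow> 'a \<Rightarrow> nat \<Rightarrow> nat" where
  "bucket \<epsilon> M v i j =
     (if v i j \<le> \<epsilon>\<^sup>2 * M j then 0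
      else if v i j > \<epsilon>\<^sup>2 * (1 + \<epsilon>\<^sup>2) ^ bucketK \<epsilon> * M j then bucketK \<epsilon> + 1
      else (LEAST k. 1 \<le> k \<and> v i j \<le> \<epsilon>\<^sup>2 * (1 + \<epsilon>\<^sup>2) ^ k * M j))"

definition elig1 where
  "elig1 E m C v w \<epsilon> M Q (b :: nat \<Rightarrow> nat \<Rightarrow> real) i j \<longleftrightarrow>
     i \<in> E \<and> i \<notin> Q \<and> j < m \<and> 1 \<le> bucket \<epsilon> M v i j \<and> w i j \<le> C j \<and>
     b j (bucket \<epsilon> M v i j) > 0"

definition elig0 where
  "elig0 E m C v w \<epsilon> M Q (b :: nat \<Rightarrow> nat \<Rightarrow> real) i j \<longleftrightarrow>
     i \<in> E \<and> i \<notin> Q \<and> j < m \<and> bucket \<epsilon> M v i j = 0 \<and> w i j \<le> C j \<and> b j 0 > 0"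

definition step1 where
  "step1 E m C v w \<epsilon> M = (\<lambda>(Q, b) (Q', b').
     \<exists>i j. elig1 E m C v w \<epsilon> M Q b i j \<and>
       (\<forall>i' j'. elig1 E m C v w \<epsilon> M Q b i' j' \<longrightarrow> w i j \<le> w i' j') \<and>
       Q' = insert i Q \<and>
       b' = b(j := (b j)(bucket \<epsilon> M v i j := b j (bucket \<epsilon> M v i j) - w i j)))"

definition step0 where
  "step0 E m C v w \<epsilon> M = (\<lambda>(Q, b) (Q', b').
     \<exists>i j. elig0 E m C v w \<epsilon> M Q b i j \<and>
       (\<forall>i' j'. elig0 E m C v w \<epsilon> M Q b i' j' \<longrightarrow> v i' j' / w i' j' \<le> v i j / w i j) \<and>
       Q' = insert i Q \<and>
       b' = b(j := (b j)(0 := b j 0 - w i j)))"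

definition sparsifier_round where
  "sparsifier_round E m C v w \<epsilon> p M Q Q' \<longleftrightarrow>
     (\<exists>Q1 b1 b2.
        (step1 E m C v w \<epsilon> M)\<^sup>*\<^sup>* (Q, \<lambda>j k. tau (\<epsilon>\<^sup>2) / p * C j) (Q1, b1) \<and>
        \<not> (\<exists>i j. elig1 E m C v w \<epsilon> M Q1 b1 i j) \<and>
        (step0 E m C v w \<epsilon> M)\<^sup>*\<^sup>* (Q1, b1) (Q', b2) \<and>
        \<not> (\<exists>i j. elig0 E m C v w \<epsilon> M Q' b2 i j))"

text \<open>Q is a possible output of the sparsifier: alpha = 1/\<epsilon>, rounds t = 1, ..., alpha - 1.\<close>
definition num_rounds :: "real \<Rightarrow> nat" where
  "num_rounds \<epsilon> = nat (\<lfloor>1 / \<epsilon>\<rfloor> - 1)"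

definition sparsifier_output where
  "sparsifier_output E m C v w \<epsilon> p M Q \<longleftrightarrow>
     (sparsifier_round E m C v w \<epsilon> p M ^^ num_rounds \<epsilon>) {} Q"

end

theory Submission
  imports Defs
begin

text \<open>
  Degree: a round charges at most (tau / p + 1) C j to each of the K + 2 budgets of knapsack j,
  and a total load of D C j can be split into 2 D + 1 bins of capacity C j.

  Value: the rounds query disjoint item sets, so some round T carries at most a 1 / num_rounds
  share of the expected optimum. Resample the activity of the items of T: the optimum of the
  original realization loses its items in T, keeps its other queried items, and its unqueried
  items are replaced by newly active items of T, which are independent of it. An unqueried item
  of bucket k of knapsack j met an exhausted budget, so T contains items of total weight at least
  (tau / p) C j charged to that bucket, all of them lighter (k > 0) or denser (k = 0) than it; with
  probability at least 1 - 2 eps^2 the active ones among them weigh at least C j. They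
  then replace the lost items of the bucket at no extra weight, losing a factor 1 + eps^2
  of value for 0 < k \<le> K and an additive eps^2 M j for k = 0. In the top bucket a
  single active item of T is worth at least 2 M j, hence more than the whole knapsack.
\<close>

section \<open>Expectation over the active set\<close>

text \<open>Expanding the product over \<open>E\<close> picks for each item the term
  \<open>p * h i\<close> (active) or \<open>1 - p\<close> (inactive). With \<open>h\<close>
  constantly 1 this gives total mass 1; with exponential factors it computes a moment generating
  function.\<close>

lemma ER_prod:
  assumes "finite E"
  shows "ER E p (\<lambda>R. \<Prod>i\<in>R. h i) = (\<Prod>i\<in>E. p * h i + (1 - p))"
  unfolding ER_def prod_add[OF assms]
  by (intro sum.cong) (auto simp: prod.distrib mult_ac)

lemma ER_const:
  assumes "finite E"
  shows "ER E p (\<lambda>_. c) = c"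
proof -
  have "ER E p (\<lambda>_. c) = c * ER E p (\<lambda>R. \<Prod>i\<in>R. 1)"
    by (simp add: ER_def sum_distrib_left mult_ac)
  then show ?thesis
    using ER_prod[OF assms, of p "\<lambda>_. 1"] by simp
qed

lemma ER_mono:
  assumes "0 \<le> p" "p \<le> 1" "\<And>R. R \<subseteq> E \<Longrightarrow> f R \<le> g R"
  shows "ER E p f \<le> ER E p g"
  unfolding ER_def by (intro sum_mono mult_left_mono) (use assms in auto)

lemma ER_add: "ER E p (\<lambda>R. f R + g R) = ER E p f + ER E p g"
  by (simp add: ER_def ring_distribs sum.distrib)

lemma ER_diff: "ER E p (\<lambda>R. f R - g R) = ER E p f - ER E p g"
  by (simp add: ER_def ring_distribs sum_subtractf)

lemma ER_cmult: "ER E p (\<lambda>R. c * f R) = c * ER E p f"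
  unfolding ER_def sum_distrib_left by (intro sum.cong) (simp_all add: mult_ac)

lemma ER_cmult_right: "ER E p (\<lambda>R. f R * c) = ER E p f * c"
  unfolding ER_def sum_distrib_right by (intro sum.cong) (simp_all add: mult_ac)

lemma ER_sum: "ER E p (\<lambda>R. \<Sum>i\<in>I. f i R) = (\<Sum>i\<in>I. ER E p (f i))"
  unfolding ER_def by (subst sum.swap) (simp add: sum_distrib_left)

lemma ER_cong: "(\<And>R. R \<subseteq> E \<Longrightarrow> f R = g R) \<Longrightarrow> ER E p f = ER E p g"
  unfolding ER_def by (intro sum.cong) auto

text \<open>Activities on disjoint sets are independent; this Fubini identity is what allows the
  items of one round to be resampled.\<close>

lemma ER_Un:
  assumes "finite A" "finite B" "A \<inter> B = {}"
  shows "ER (A \<union> B) p g = ER A p (\<lambda>X. ER B p (\<lambda>Y. g (X \<union> Y)))"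
proof -
  have bij: "bij_betw (\<lambda>(X, Y). X \<union> Y) (Pow A \<times> Pow B) (Pow (A \<union> B))"
    by (rule bij_betw_byWitness[where f' = "\<lambda>R. (R \<inter> A, R \<inter> B)"]) (use assms in auto)
  have "ER (A \<union> B) p g = (\<Sum>(X, Y)\<in>Pow A \<times> Pow B.
      p ^ card (X \<union> Y) * (1 - p) ^ card (A \<union> B - (X \<union> Y)) * g (X \<union> Y))"
    unfolding ER_def by (subst sum.reindex_bij_betw[OF bij, symmetric]) (simp add: case_prod_unfold)
  also have "\<dots> = (\<Sum>(X, Y)\<in>Pow A \<times> Pow B.
      p ^ card X * (1 - p) ^ card (A - X) * (p ^ card Y * (1 - p) ^ card (B - Y) * g (X \<union> Y)))"
  proof (intro sum.cong refl, clarify)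
    fix X Y assume XY: "X \<subseteq> A" "Y \<subseteq> B"
    have "finite X" "finite Y"
      using XY assms finite_subset by blast+
    moreover have "X \<inter> Y = {}" "(A - X) \<inter> (B - Y) = {}" "A \<union> B - (X \<union> Y) = (A - X) \<union> (B - Y)"
      using XY assms by auto
    ultimately have "card (X \<union> Y) = card X + card Y"
      "card (A \<union> B - (X \<union> Y)) = card (A - X) + card (B - Y)"
      using assms by (simp_all add: card_Un_disjoint)
    then show "p ^ card (X \<union> Y) * (1 - p) ^ card (A \<union> B - (X \<union> Y)) * g (X \<union> Y) =
        p ^ card X * (1 - p) ^ card (A - X) * (p ^ card Y * (1 - p) ^ card (B - Y) * g (X \<union> Y))"
      by (simp add: power_add mult_ac)
  qed
  also have "\<dots> = ER A p (\<lambda>X. ER B p (\<lambda>Y. g (X \<union> Y)))"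
    unfolding ER_def by (simp add: sum.cartesian_product[symmetric] sum_distrib_left)
  finally show ?thesis .
qed

text \<open>Convexity: on [0, 1] the function lies below the chord joining its end values 1 and
  1/2.\<close>

lemma two_powr_minus_le:
  fixes a :: real
  assumes "0 \<le> a" "a \<le> 1"
  shows "2 powr (- a) \<le> 1 - a / 2"
proof -
  have "exp ((1 - a) *\<^sub>R 0 + a *\<^sub>R (- ln 2)) \<le> (1 - a) * exp 0 + a * exp (- ln (2::real))"
    using assms by (intro convex_onD[OF exp_convex]) auto
  then show ?thesis
    by (simp add: powr_def exp_minus field_simps)
qed

text \<open>A Chernoff bound: Markov's inequality for the function 2 to the minus (active weight / c).\<close>

lemma ER_active_weight_ge:
  assumes fin: "finite E" and "P \<subseteq> E" and p: "0 < p" "p \<le> 1" and c: "0 < c"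
    and wt: "\<And>i. i \<in> P \<Longrightarrow> 0 \<le> wt i \<and> wt i \<le> c"
    and total: "T / p * c \<le> sum wt P"
  shows "1 - 2 * exp (- (T / 2)) \<le> ER E p (\<lambda>R. of_bool (c \<le> sum wt (P \<inter> R)))"
proof -
  define h where "h i = (if i \<in> P then 2 powr (- (wt i / c)) else 1)" for i
  have h_le: "p * h i + (1 - p) \<le> (if i \<in> P then exp (- (p * (wt i / c) / 2)) else 1)" for i
  proof (cases "i \<in> P")
    case True
    have "h i \<le> 1 - wt i / c / 2"
      using True wt[of i] c two_powr_minus_le[of "wt i / c"] by (simp add: h_def)
    then have "p * h i \<le> p * (1 - wt i / c / 2)"
      using p by simp
    then have "p * h i + (1 - p) \<le> 1 + - (p * (wt i / c) / 2)"
      by (simp add: algebra_simps)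
    also have "\<dots> \<le> exp (- (p * (wt i / c) / 2))"
      by (rule exp_ge_add_one_self)
    finally show ?thesis using True by simp
  qed (simp add: h_def)
  have "ER E p (\<lambda>R. \<Prod>i\<in>R. h i) \<le> (\<Prod>i\<in>E. if i \<in> P then exp (- (p * (wt i / c) / 2)) else 1)"
    unfolding ER_prod[OF fin]
    by (intro prod_mono conjI h_le) (use p in \<open>auto simp: h_def\<close>)
  also have "\<dots> = (\<Prod>i\<in>P. exp (- (p * (wt i / c) / 2)))"
    using \<open>P \<subseteq> E\<close> fin by (simp add: prod.If_cases inf.absorb2)
  also have "\<dots> = exp (- (p * (sum wt P / c) / 2))"
    using finite_subset[OF \<open>P \<subseteq> E\<close> fin]
    by (simp add: exp_sum[symmetric] sum_negf sum_divide_distrib sum_distrib_left)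
  also have "\<dots> \<le> exp (- (T / 2))"
    using total p c by (simp add: field_simps)
  finally have mgf: "ER E p (\<lambda>R. \<Prod>i\<in>R. h i) \<le> exp (- (T / 2))" .
  \<comment> \<open>If the active weight stays below \<open>c\<close>, the product exceeds 1/2 and
    the left side is negative; otherwise the left side is at most 1.\<close>
  have "1 - 2 * (\<Prod>i\<in>R. h i) \<le> of_bool (c \<le> sum wt (P \<inter> R))" if "R \<subseteq> E" for R
  proof -
    have "finite R" using that fin finite_subset by blast
    then have "(\<Prod>i\<in>R. h i) = (\<Prod>i\<in>P \<inter> R. 2 powr (- (wt i / c)))"
      unfolding h_def by (simp add: prod.If_cases Int_commute)
    also have "\<dots> = 2 powr (- (sum wt (P \<inter> R) / c))"
      using \<open>finite R\<close> by (simp add: powr_sum[symmetric] sum_negf sum_divide_distrib)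
    finally have eq: "(\<Prod>i\<in>R. h i) = 2 powr (- (sum wt (P \<inter> R) / c))" .
    show ?thesis
    proof (cases "c \<le> sum wt (P \<inter> R)")
      case False
      then have "2 powr (- 1) \<le> 2 powr (- (sum wt (P \<inter> R) / c))"
        using c by (intro powr_mono) auto
      then show ?thesis using False eq by (simp add: powr_minus)
    qed (simp add: eq)
  qed
  then have "ER E p (\<lambda>R. 1 - 2 * (\<Prod>i\<in>R. h i)) \<le> ER E p (\<lambda>R. of_bool (c \<le> sum wt (P \<inter> R)))"
    using p by (intro ER_mono) auto
  then show ?thesis
    using mgf by (simp add: ER_diff ER_const[OF fin] ER_cmult)
qed

section \<open>Packing into the feasibility polytope\<close>

text \<open>Greedy packing by decreasing weight: if an item fits into no bin, every bin is
  nonempty, hence holds an earlier, heavier item, and so is more than half full.\<close>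

lemma bin_packing:
  fixes wt :: "'a \<Rightarrow> real"
  assumes "finite S" and "\<And>x. x \<in> S \<Longrightarrow> 0 < wt x \<and> wt x \<le> c"
    and "sum wt S \<le> D * c" and "0 \<le> c" and N: "2 * D \<le> real N" "0 < N"
  shows "\<exists>b. b ` S \<subseteq> {..<N} \<and> (\<forall>r<N. sum wt {x\<in>S. b x = r} \<le> c)"
  using assms(1-3)
\<comment> \<open>Ranking by \<open>- wt\<close> inserts the items by decreasing weight, so the new
  item \<open>x\<close> is a lightest one.\<close>
proof (induction S rule: finite_ranking_induct[where f = "\<lambda>x. - wt x"])
  case empty
  then show ?case using \<open>0 \<le> c\<close> by simp
next
  case (insert x S)
  show ?case
  proof (cases "x \<in> S")
    case True
    then show ?thesis using insert by (simp add: insert_absorb)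
  next
    case False
    have x: "0 < wt x" "wt x \<le> c" and tot: "wt x + sum wt S \<le> D * c"
      using insert.prems insert.hyps(1) False by auto
    obtain b where b: "b ` S \<subseteq> {..<N}" "\<And>r. r < N \<Longrightarrow> sum wt {x\<in>S. b x = r} \<le> c"
      using insert.IH insert.prems tot x by force
    have "\<exists>r<N. sum wt {y\<in>S. b y = r} + wt x \<le> c"
    proof (rule ccontr)
      assume "\<not> ?thesis"
      then have over: "c < sum wt {y\<in>S. b y = r} + wt x" if "r < N" for r
        using that by force
      have half: "c / 2 \<le> sum wt {y\<in>S. b y = r}" if "r < N" for r
      proof -
        have "{y\<in>S. b y = r} \<noteq> {}"
          using over[OF that] x by force
        then obtain y where y: "y \<in> S" "b y = r" by blast
        then have "wt x \<le> wt y" using insert.hyps(2) by force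
        also have "\<dots> \<le> sum wt {y\<in>S. b y = r}"
          using y insert.hyps(1) insert.prems(1) by (intro member_le_sum) (auto intro: less_imp_le)
        finally show ?thesis using over[OF that] by simp
      qed
      \<comment> \<open>Bins that are all at least half full hold at least \<open>D * c\<close> in
        total, which leaves nothing for the positive weight of \<open>x\<close>.\<close>
      have "D * c \<le> real N * (c / 2)"
        using mult_right_mono[OF N(1) \<open>0 \<le> c\<close>] by simp
      also have "\<dots> = (\<Sum>r<N. c / 2)" by simp
      also have "\<dots> \<le> (\<Sum>r<N. sum wt {y\<in>S. b y = r})"
        by (intro sum_mono half) simp
      also have "\<dots> = sum wt S"
        using insert.hyps(1) b(1) by (intro sum.group) auto
      finally show False using tot x by simp
    qed
    then obtain r where r: "r < N" "sum wt {y\<in>S. b y = r} + wt x \<le> c" by blast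
    define b' where "b' = b(x := r)"
    have "sum wt {y \<in> insert x S. b' y = s} \<le> c" if "s < N" for s
    proof (cases "s = r")
      case True
      have "{y \<in> insert x S. b' y = s} = insert x {y\<in>S. b y = r}"
        using True False by (auto simp: b'_def)
      then show ?thesis using r False insert.hyps(1) by simp
    next
      case neq: False
      have "{y \<in> insert x S. b' y = s} = {y\<in>S. b y = s}"
        using neq False by (auto simp: b'_def)
      then show ?thesis using b that by simp
    qed
    moreover have "b' ` insert x S \<subseteq> {..<N}"
      using b(1) r(1) by (auto simp: b'_def)
    ultimately show ?thesis by blast
  qed
qed

text \<open>Each of the \<open>N\<close> sets receives the coefficient \<open>1 / d\<close>, and the
  empty set absorbs the remaining mass \<open>1 - N / d\<close>. The same set may occur for several
  \<open>r\<close>, so \<open>lam\<close> adds up over all of them.\<close>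

lemma in_PF_convex_combination:
  assumes "finite E" and N: "0 < d" "real N \<le> d"
    and S: "\<And>r. r < N \<Longrightarrow> S r \<subseteq> E \<and> gap_feasible E m C w (S r)"
    and empty: "gap_feasible E m C w {}"
  shows "in_PF E m C w (\<lambda>i. \<Sum>r<N. (1 / d) * indicator (S r) i)"
proof -
  define F where "F = {S. S \<subseteq> E \<and> gap_feasible E m C w S}"
  have F: "finite F" "{} \<in> F" "\<And>r. r < N \<Longrightarrow> S r \<in> F"
    using S empty \<open>finite E\<close> by (auto simp: F_def)
  define lam where
    "lam T = (\<Sum>r<N. (1 / d) * of_bool (S r = T)) + (1 - real N / d) * of_bool (T = {})" for T
  have comb: "(\<Sum>T\<in>F. lam T * x T) = (\<Sum>r<N. (1 / d) * x (S r)) + (1 - real N / d) * x {}"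
    for x :: "'a set \<Rightarrow> real"
  proof -
    have "(\<Sum>T\<in>F. lam T * x T) =
        (\<Sum>T\<in>F. \<Sum>r<N. (1 / d) * of_bool (S r = T) * x T) + (\<Sum>T\<in>F. (1 - real N / d) * of_bool (T = {}) * x T)"
      by (simp only: lam_def ring_distribs sum.distrib sum_distrib_right)
    also have "(\<Sum>T\<in>F. \<Sum>r<N. (1 / d) * of_bool (S r = T) * x T) = (\<Sum>r<N. \<Sum>T\<in>F. if T = S r then (1 / d) * x T else 0)"
      by (subst sum.swap, intro sum.cong) auto
    also have "\<dots> = (\<Sum>r<N. (1 / d) * x (S r))"
      using F by (intro sum.cong) (simp_all add: sum.delta)
    also have "(\<Sum>T\<in>F. (1 - real N / d) * of_bool (T = {}) * x T) = (\<Sum>T\<in>F. if T = {} then (1 - real N / d) * x T else 0)"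
      by (intro sum.cong) auto
    also have "\<dots> = (1 - real N / d) * x {}"
      using F by (simp add: sum.delta)
    finally show ?thesis .
  qed
  show ?thesis
    unfolding in_PF_def F_def[symmetric]
  proof (intro exI[of _ lam] conjI ballI)
    show "0 \<le> lam T" for T
      unfolding lam_def using N by (intro add_nonneg_nonneg sum_nonneg mult_nonneg_nonneg) auto
    show "sum lam F = 1"
      using comb[of "\<lambda>_. 1"] N by simp
    show "(\<Sum>r<N. (1 / d) * indicator (S r) i) = (\<Sum>T\<in>F. lam T * indicator T i)" for i
      using comb[of "\<lambda>T. indicator T i"] by simp
  qed
qed

lemma is_assignment_of_map:
  assumes "S \<subseteq> E" "\<And>i. i \<in> S \<Longrightarrow> g i < m"
    and "\<And>j. j < m \<Longrightarrow> (\<Sum>i\<in>{i\<in>S. g i = j}. w i j) \<le> C j"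
  shows "is_assignment E m C w ((\<lambda>i. (i, g i)) ` S)"
  unfolding is_assignment_def
proof (intro conjI allI impI)
  fix j assume "j < m"
  have "{q \<in> (\<lambda>i. (i, g i)) ` S. snd q = j} = (\<lambda>i. (i, j)) ` {i\<in>S. g i = j}"
    by auto
  then have "(\<Sum>q\<in>{q \<in> (\<lambda>i. (i, g i)) ` S. snd q = j}. w (fst q) (snd q)) = (\<Sum>i\<in>{i\<in>S. g i = j}. w i j)"
    by (simp add: sum.reindex inj_on_def)
  then show "(\<Sum>q\<in>{q \<in> (\<lambda>i. (i, g i)) ` S. snd q = j}. w (fst q) (snd q)) \<le> C j"
    using assms(3)[OF \<open>j < m\<close>] by simp
qed (use assms in auto)

text \<open>The load of every knapsack is packed into \<open>N\<close> bins. The bins number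
  \<open>r\<close> of all knapsacks together form one feasible set, and these \<open>N\<close> sets
  partition \<open>Q\<close>.\<close>

lemma in_PF_of_load:
  assumes gap: "gap_instance E m C v w" and "Q \<subseteq> E"
    and g: "\<And>i. i \<in> Q \<Longrightarrow> g i < m \<and> w i (g i) \<le> C (g i)"
    and load: "\<And>j. j < m \<Longrightarrow> (\<Sum>i\<in>{i\<in>Q. g i = j}. w i j) \<le> D * C j"
    and d: "0 \<le> D" "2 * D + 1 \<le> d"
  shows "in_PF E m C w (\<lambda>i. (1 / d) * indicator Q i)"
proof -
  \<comment> \<open>At least \<open>2 * D\<close> bins, at least one bin even when
    \<open>D = 0\<close>, and at most \<open>d\<close> bins.\<close>
  define N where "N = nat (\<lfloor>2 * D\<rfloor> + 1)"
  have N: "2 * D \<le> real N" "0 < N" "real N \<le> d"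
    using d unfolding N_def by linarith+
  have fin: "finite E" "finite Q" and C: "\<And>j. j < m \<Longrightarrow> 0 \<le> C j"
    and w: "\<And>i j. i \<in> E \<Longrightarrow> j < m \<Longrightarrow> 0 < w i j"
    using gap \<open>Q \<subseteq> E\<close> finite_subset by (auto simp: gap_instance_def)
  have "\<forall>j. \<exists>b. j < m \<longrightarrow> b ` {i\<in>Q. g i = j} \<subseteq> {..<N} \<and>
      (\<forall>r<N. (\<Sum>i\<in>{i\<in>{i\<in>Q. g i = j}. b i = r}. w i j) \<le> C j)"
  proof (intro allI)
    fix j
    show "\<exists>b. j < m \<longrightarrow> b ` {i\<in>Q. g i = j} \<subseteq> {..<N} \<and>
      (\<forall>r<N. (\<Sum>i\<in>{i\<in>{i\<in>Q. g i = j}. b i = r}. w i j) \<le> C j)"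
    proof (cases "j < m")
      case True
      have "\<exists>b. b ` {i\<in>Q. g i = j} \<subseteq> {..<N} \<and>
        (\<forall>r<N. (\<Sum>i\<in>{i\<in>{i\<in>Q. g i = j}. b i = r}. w i j) \<le> C j)"
        by (rule bin_packing[where D = D])
          (use True fin g w load N C \<open>Q \<subseteq> E\<close> in auto)
      then show ?thesis by blast
    qed simp
  qed
  then obtain b where b: "\<And>j. j < m \<Longrightarrow> b j ` {i\<in>Q. g i = j} \<subseteq> {..<N}"
      "\<And>j r. j < m \<Longrightarrow> r < N \<Longrightarrow> (\<Sum>i\<in>{i\<in>{i\<in>Q. g i = j}. b j i = r}. w i j) \<le> C j"
    unfolding choice_iff by blast
  define S where "S r = {i\<in>Q. b (g i) i = r}" for r
  have feas: "S r \<subseteq> E \<and> gap_feasible E m C w (S r)" if "r < N" for r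
  proof
    show "S r \<subseteq> E" using \<open>Q \<subseteq> E\<close> by (auto simp: S_def)
    have "is_assignment E m C w ((\<lambda>i. (i, g i)) ` S r)"
    proof (rule is_assignment_of_map)
      fix j assume "j < m"
      have "{i\<in>S r. g i = j} = {i\<in>{i\<in>Q. g i = j}. b j i = r}"
        by (auto simp: S_def)
      then show "(\<Sum>i\<in>{i\<in>S r. g i = j}. w i j) \<le> C j"
        using b(2)[OF \<open>j < m\<close> that] by simp
    qed (use g \<open>Q \<subseteq> E\<close> in \<open>auto simp: S_def\<close>)
    moreover have "fst ` (\<lambda>i. (i, g i)) ` S r = S r" by force
    ultimately show "gap_feasible E m C w (S r)"
      unfolding gap_feasible_def by blast
  qed
  have empty: "gap_feasible E m C w {}"
    unfolding gap_feasible_def is_assignment_def using C by (intro exI[of _ "{}"]) simp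
  have "(\<Sum>r<N. (1 / d) * indicator (S r) i) = (1 / d) * indicator Q i" for i
  proof (cases "i \<in> Q")
    case True
    then have "b (g i) i < N" using b(1)[of "g i"] g by auto
    then have "(\<Sum>r<N. if r = b (g i) i then 1 / d else 0) = 1 / d"
      by (simp add: sum.delta)
    moreover have "(\<Sum>r<N. (1 / d) * indicator (S r) i) = (\<Sum>r<N. if r = b (g i) i then 1 / d else 0)"
      using True by (intro sum.cong) (auto simp: S_def)
    ultimately show ?thesis using True by simp
  qed (simp add: S_def)
  moreover have "in_PF E m C w (\<lambda>i. \<Sum>r<N. (1 / d) * indicator (S r) i)"
    by (rule in_PF_convex_combination[OF fin(1) _ N(3) feas empty]) (use N in linarith)
  ultimately show ?thesis by simp
qed

section \<open>Replacing lost items\<close>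

text \<open>No element of \<open>A\<close> is heavier than any element of \<open>O'\<close>, yet
  \<open>A\<close> weighs at least as much in total. Hence \<open>A\<close> has at least as many
  elements, and an injection of \<open>O'\<close> into \<open>A\<close> allows a comparison item by
  item.\<close>

lemma replace_by_lighter:
  fixes wt vl :: "'a \<Rightarrow> real"
  assumes fin: "finite O'" "finite A" and pos: "\<And>i. i \<in> O' \<Longrightarrow> 0 < wt i"
    and "sum wt O' \<le> c" "c \<le> sum wt A"
    and light: "\<And>a i. a \<in> A \<Longrightarrow> i \<in> O' \<Longrightarrow> wt a \<le> wt i"
    and val: "\<And>a i. a \<in> A \<Longrightarrow> i \<in> O' \<Longrightarrow> vl i \<le> \<gamma> * vl a"
  obtains B where "B \<subseteq> A" "sum wt B \<le> sum wt O'" "sum vl O' \<le> \<gamma> * sum vl B"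
proof (cases "O' = {}")
  case True
  then show ?thesis using that[of "{}"] by simp
next
  case False
  have "card O' \<le> card A"
  proof (rule ccontr)
    assume "\<not> card O' \<le> card A"
    define u where "u = Min (wt ` O')"
    have u: "u \<le> wt i" if "i \<in> O'" for i
      using that fin by (simp add: u_def)
    have "u \<in> wt ` O'"
      using False fin unfolding u_def by (intro Min_in) auto
    then have "0 < u" and ua: "\<And>a. a \<in> A \<Longrightarrow> wt a \<le> u"
      using pos light by auto
    have "sum wt A \<le> real (card A) * u"
      using sum_bounded_above[of A wt u] ua by simp
    also have "\<dots> < real (card O') * u"
      using \<open>\<not> card O' \<le> card A\<close> \<open>0 < u\<close> by simp
    also have "\<dots> \<le> sum wt O'"
      using sum_bounded_below[of O' u wt] u by simp
    finally show False using assms by linarith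
  qed
  then obtain B where B: "B \<subseteq> A" "card B = card O'"
    by (meson obtain_subset_with_card_n)
  have "finite B" using B fin finite_subset by blast
  then obtain h where h: "bij_betw h O' B"
    using finite_same_card_bij[OF fin(1)] B(2) by metis
  have hA: "h i \<in> A" if "i \<in> O'" for i
    using h B that by (auto simp: bij_betw_def)
  show ?thesis
  proof (rule that[OF B(1)])
    have "sum wt B = (\<Sum>i\<in>O'. wt (h i))"
      by (rule sum.reindex_bij_betw[OF h, symmetric])
    also have "\<dots> \<le> sum wt O'"
      by (intro sum_mono light hA)
    finally show "sum wt B \<le> sum wt O'" .
    have "sum vl O' \<le> (\<Sum>i\<in>O'. \<gamma> * vl (h i))"
      by (intro sum_mono val hA)
    also have "\<dots> = \<gamma> * sum vl B"
      by (simp add: sum.reindex_bij_betw[OF h] sum_distrib_left[symmetric])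
    finally show "sum vl O' \<le> \<gamma> * sum vl B" .
  qed
qed

text \<open>\<open>B\<close> is a maximal subset of \<open>A\<close> that is no heavier than
  \<open>O'\<close>. One further item would make it heavier than \<open>O'\<close> and, being
  denser, at least as valuable; so \<open>B\<close> falls short by at most the value of that
  item.\<close>

lemma replace_by_denser:
  fixes wt vl :: "'a \<Rightarrow> real"
  assumes fin: "finite O'" "finite A"
    and pos: "\<And>i. i \<in> O' \<Longrightarrow> 0 < wt i \<and> 0 \<le> vl i" "\<And>a. a \<in> A \<Longrightarrow> 0 < wt a"
    and "sum wt O' \<le> c" "c \<le> sum wt A"
    and dense: "\<And>a i. a \<in> A \<Longrightarrow> i \<in> O' \<Longrightarrow> vl i / wt i \<le> vl a / wt a"
    and small: "\<And>a. a \<in> A \<Longrightarrow> vl a \<le> \<mu>" and "0 \<le> \<mu>"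
  obtains B where "B \<subseteq> A" "sum wt B \<le> sum wt O'" "sum vl O' \<le> sum vl B + \<mu>"
proof (cases "O' = {}")
  case True
  then show ?thesis using that[of "{}"] \<open>0 \<le> \<mu>\<close> by simp
next
  case False
  \<comment> \<open>A threshold density: no item of \<open>O'\<close> lies above it and no item of
    \<open>A\<close> below it.\<close>
  define \<rho> where "\<rho> = Max ((\<lambda>i. vl i / wt i) ` O')"
  have \<rho>_O: "vl i \<le> \<rho> * wt i" if "i \<in> O'" for i
  proof -
    have "vl i / wt i \<le> \<rho>" using that fin by (simp add: \<rho>_def)
    then show ?thesis using pos(1)[OF that] by (simp add: field_simps)
  qed
  have "\<rho> \<in> (\<lambda>i. vl i / wt i) ` O'"
    using False fin unfolding \<rho>_def by (intro Max_in) auto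
  then obtain k where k: "k \<in> O'" "\<rho> = vl k / wt k" by blast
  then have "0 \<le> \<rho>" using pos(1) by (simp add: less_imp_le)
  have \<rho>_A: "\<rho> * wt a \<le> vl a" if "a \<in> A" for a
    using dense[OF that k(1)] pos(2)[OF that] k(2) by (simp add: field_simps)
  have enough: "sum vl O' \<le> sum vl S" if "S \<subseteq> A" "sum wt O' \<le> sum wt S" for S
  proof -
    have "sum vl O' \<le> \<rho> * sum wt O'"
      unfolding sum_distrib_left by (intro sum_mono \<rho>_O)
    also have "\<dots> \<le> \<rho> * sum wt S"
      using that \<open>0 \<le> \<rho>\<close> by (intro mult_left_mono)
    also have "\<dots> \<le> sum vl S"
      unfolding sum_distrib_left using that by (intro sum_mono \<rho>_A) auto
    finally show ?thesis .
  qed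
  define \<B> where "\<B> = {B. B \<subseteq> A \<and> sum wt B \<le> sum wt O'}"
  have "finite \<B>" using fin by (simp add: \<B>_def)
  moreover have "\<B> \<noteq> {}"
  proof -
    have "0 \<le> sum wt O'" using pos(1) by (intro sum_nonneg less_imp_le) blast
    then have "{} \<in> \<B>" by (simp add: \<B>_def)
    then show ?thesis by blast
  qed
  ultimately obtain B where B: "B \<in> \<B>" and maximal: "\<And>B'. B' \<in> \<B> \<Longrightarrow> B \<subseteq> B' \<Longrightarrow> B = B'"
    using finite_has_maximal by metis
  have "finite B" using B fin finite_subset by (auto simp: \<B>_def)
  show ?thesis
  proof (rule that)
    show "B \<subseteq> A" "sum wt B \<le> sum wt O'" using B by (auto simp: \<B>_def)
    show "sum vl O' \<le> sum vl B + \<mu>"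
    proof (cases "B = A")
      case True
      then show ?thesis using enough[of A] assms by simp
    next
      case False
      then obtain a where a: "a \<in> A" "a \<notin> B" using \<open>B \<subseteq> A\<close> by blast
      then have "insert a B \<notin> \<B>" using maximal[of "insert a B"] by blast
      then have "sum vl O' \<le> sum vl (insert a B)"
        using a \<open>B \<subseteq> A\<close> by (intro enough) (auto simp: \<B>_def)
      then show ?thesis using a small[of a] \<open>finite B\<close> by simp
    qed
  qed
qed

section \<open>Buckets\<close>

text \<open>For x = \<epsilon>^2 one has ln (1 + x) \<ge> x - x^2 \<ge> x / 2, and the factor 2 /
  \<epsilon>^2 in \<open>bucketK\<close> cancels this slope.\<close>

lemma bucketK_growth:
  assumes "0 < \<epsilon>" "\<epsilon> < 1 / 6"
  shows "1 / \<epsilon> ^ 3 \<le> (1 + \<epsilon>\<^sup>2) ^ bucketK \<epsilon>"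
proof -
  have \<epsilon>2: "\<epsilon>\<^sup>2 \<le> 1 / 2"
    using assms power_mono[of \<epsilon> "1 / 6" 2] by (simp add: power2_eq_square)
  have "\<epsilon>\<^sup>2 * \<epsilon>\<^sup>2 \<le> \<epsilon>\<^sup>2 * (1 / 2)"
    by (intro mult_left_mono \<epsilon>2) simp
  then have "\<epsilon>\<^sup>2 / 2 \<le> \<epsilon>\<^sup>2 - (\<epsilon>\<^sup>2)\<^sup>2"
    by (simp add: power2_eq_square[of "\<epsilon>\<^sup>2"])
  also have "\<dots> \<le> ln (1 + \<epsilon>\<^sup>2)"
    using \<epsilon>2 by (intro ln_one_plus_pos_lower_bound) auto
  finally have half: "\<epsilon>\<^sup>2 / 2 \<le> ln (1 + \<epsilon>\<^sup>2)" .
  have "ln (1 / \<epsilon> ^ 3) = (2 / \<epsilon>\<^sup>2) * ln (1 / \<epsilon> ^ 3) * (\<epsilon>\<^sup>2 / 2)"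
    using assms by simp
  also have "\<dots> \<le> real (bucketK \<epsilon>) * ln (1 + \<epsilon>\<^sup>2)"
    unfolding bucketK_def by (intro mult_mono half real_nat_ceiling_ge) simp_all
  also have "\<dots> = ln ((1 + \<epsilon>\<^sup>2) ^ bucketK \<epsilon>)"
    using assms by (simp add: ln_realpow add_pos_nonneg)
  finally show ?thesis
    using assms by (subst (asm) ln_le_cancel_iff) (auto simp: add_pos_nonneg)
qed

text \<open>\<open>bucketK \<epsilon>\<close> satisfies the condition under \<open>LEAST\<close>, so
  the minimum exists and has the upper end; minimality yields the lower end.\<close>

lemma bucket_range:
  assumes "\<not> v i j \<le> \<epsilon>\<^sup>2 * M j" "v i j \<le> \<epsilon>\<^sup>2 * (1 + \<epsilon>\<^sup>2) ^ bucketK \<epsilon> * M j"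
  shows "1 \<le> bucket \<epsilon> M v i j" "bucket \<epsilon> M v i j \<le> bucketK \<epsilon>"
    "v i j \<le> \<epsilon>\<^sup>2 * (1 + \<epsilon>\<^sup>2) ^ bucket \<epsilon> M v i j * M j"
    "\<epsilon>\<^sup>2 * (1 + \<epsilon>\<^sup>2) ^ (bucket \<epsilon> M v i j - 1) * M j < v i j"
proof -
  define Z where "Z k \<longleftrightarrow> 1 \<le> k \<and> v i j \<le> \<epsilon>\<^sup>2 * (1 + \<epsilon>\<^sup>2) ^ k * M j" for k
  have eq: "bucket \<epsilon> M v i j = (LEAST k. Z k)"
    using assms by (simp add: bucket_def Z_def)
  \<comment> \<open>With exponent 0 the two assumptions would contradict each other.\<close>
  have "bucketK \<epsilon> \<noteq> 0"
    using assms by (intro notI) simp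
  then have "Z (bucketK \<epsilon>)"
    using assms by (simp add: Z_def)
  then have "Z (bucket \<epsilon> M v i j)" and le: "bucket \<epsilon> M v i j \<le> bucketK \<epsilon>"
    unfolding eq by (rule LeastI, rule Least_le)
  then show "1 \<le> bucket \<epsilon> M v i j" "bucket \<epsilon> M v i j \<le> bucketK \<epsilon>"
    "v i j \<le> \<epsilon>\<^sup>2 * (1 + \<epsilon>\<^sup>2) ^ bucket \<epsilon> M v i j * M j"
    by (auto simp: Z_def)
  then have "\<not> Z (bucket \<epsilon> M v i j - 1)"
    unfolding eq by (intro not_less_Least) linarith
  \<comment> \<open>For bucket 1 the predecessor 0 violates only the clause \<open>1 \<le> k\<close>
    of \<open>Z\<close>; there the lower end is the first assumption.\<close>
  then show "\<epsilon>\<^sup>2 * (1 + \<epsilon>\<^sup>2) ^ (bucket \<epsilon> M v i j - 1) * M j < v i j"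
    using assms(1) by (cases "bucket \<epsilon> M v i j - 1 = 0") (auto simp: Z_def)
qed

lemma bucket_eq_0: "bucket \<epsilon> M v i j = 0 \<Longrightarrow> v i j \<le> \<epsilon>\<^sup>2 * M j"
  using bucket_range(1)[of v i j \<epsilon> M] by (force simp: bucket_def split: if_splits)

lemma bucket_le: "bucket \<epsilon> M v i j \<le> bucketK \<epsilon> + 1"
  using bucket_range(2)[of v i j \<epsilon> M] by (force simp: bucket_def)

lemma bucket_top:
  assumes "bucket \<epsilon> M v i j = bucketK \<epsilon> + 1"
  shows "\<epsilon>\<^sup>2 * (1 + \<epsilon>\<^sup>2) ^ bucketK \<epsilon> * M j < v i j"
proof (rule ccontr)
  assume "\<not> ?thesis"
  moreover from this have "bucket \<epsilon> M v i j \<le> bucketK \<epsilon>" if "\<not> v i j \<le> \<epsilon>\<^sup>2 * M j"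
    using bucket_range(2)[of v i j \<epsilon> M, OF that] by simp
  ultimately show False using assms by (auto simp: bucket_def split: if_splits)
qed

text \<open>The two ends of an inner bucket differ by exactly this factor.\<close>

lemma bucket_same:
  assumes "bucket \<epsilon> M v i j = k" "bucket \<epsilon> M v i' j = k" "1 \<le> k" "k \<le> bucketK \<epsilon>"
  shows "v i j \<le> (1 + \<epsilon>\<^sup>2) * v i' j"
proof -
  have mid: "\<not> v a j \<le> \<epsilon>\<^sup>2 * M j" "v a j \<le> \<epsilon>\<^sup>2 * (1 + \<epsilon>\<^sup>2) ^ bucketK \<epsilon> * M j"
    if "bucket \<epsilon> M v a j = k" for a
    using that assms(3,4) by (auto simp: bucket_def split: if_splits)
  have "v i j \<le> \<epsilon>\<^sup>2 * (1 + \<epsilon>\<^sup>2) ^ k * M j"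
    using bucket_range(3)[of v i j \<epsilon> M, OF mid] assms by blast
  also have "\<dots> = (1 + \<epsilon>\<^sup>2) * (\<epsilon>\<^sup>2 * (1 + \<epsilon>\<^sup>2) ^ (k - 1) * M j)"
    using \<open>1 \<le> k\<close> by (cases k) simp_all
  also have "\<dots> \<le> (1 + \<epsilon>\<^sup>2) * v i' j"
    using bucket_range(4)[of v i' j \<epsilon> M, OF mid] assms by (intro mult_left_mono) auto
  finally show ?thesis .
qed

section \<open>A round of the sparsifier\<close>

locale gap =
  fixes E :: "'a set" and m :: nat and C :: "nat \<Rightarrow> real" and v w :: "'a \<Rightarrow> nat \<Rightarrow> real"
    and \<epsilon> :: real and M :: "nat \<Rightarrow> real"
  assumes gap_inst: "gap_instance E m C v w"
begin

lemma finite_E: "finite E"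
  and C_nonneg: "j < m \<Longrightarrow> 0 \<le> C j"
  and v_nonneg: "i \<in> E \<Longrightarrow> j < m \<Longrightarrow> 0 \<le> v i j"
  and w_pos: "i \<in> E \<Longrightarrow> j < m \<Longrightarrow> 0 < w i j"
  using gap_inst by (auto simp: gap_instance_def)

abbreviation bkt :: "'a \<Rightarrow> nat \<Rightarrow> nat" where
  "bkt \<equiv> bucket \<epsilon> M v"

text \<open>The map g records the knapsack whose budget an item was charged to.\<close>

definition pool :: "('a \<Rightarrow> nat) \<Rightarrow> 'a set \<Rightarrow> nat \<Rightarrow> nat \<Rightarrow> 'a set" where
  "pool g X j k = {i\<in>X. g i = j \<and> bkt i j = k}"

text \<open>The greedy order of the phase that handles the bucket of \<open>i\<close>. It is applied
  to items \<open>a\<close> of the same bucket of \<open>j\<close>, so testing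
  \<open>bkt i j\<close> decides for both.\<close>

definition dominates :: "nat \<Rightarrow> 'a \<Rightarrow> 'a \<Rightarrow> bool" where
  "dominates j a i \<longleftrightarrow>
     (if bkt i j = 0 then v i j / w i j \<le> v a j / w a j else w a j \<le> w i j)"

text \<open>\<open>Q0\<close> is the query set at the start of the round. A budget is charged only
  while positive and only by an item that fits, so it never falls below
  \<open>- C j\<close>.\<close>

definition round_invar ::
  "real \<Rightarrow> 'a set \<Rightarrow> 'a set \<Rightarrow> (nat \<Rightarrow> nat \<Rightarrow> real) \<Rightarrow> ('a \<Rightarrow> nat) \<Rightarrow> bool" where
  "round_invar \<beta> Q0 Q b g \<longleftrightarrow>
     Q0 \<subseteq> Q \<and> Q - Q0 \<subseteq> E \<and>
     (\<forall>i\<in>Q - Q0. g i < m \<and> w i (g i) \<le> C (g i)) \<and>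
     (\<forall>j<m. \<forall>k. b j k = \<beta> * C j - (\<Sum>i\<in>pool g (Q - Q0) j k. w i j) \<and> - C j \<le> b j k) \<and>
     (\<forall>i\<in>E - Q. \<forall>j<m. w i j \<le> C j \<longrightarrow> (\<forall>a\<in>pool g (Q - Q0) j (bkt i j). dominates j a i))"

lemma round_invar_init:
  assumes "0 \<le> \<beta>"
  shows "round_invar \<beta> Q0 Q0 (\<lambda>j k. \<beta> * C j) g"
proof -
  have "- C j \<le> \<beta> * C j" if "j < m" for j
    using mult_nonneg_nonneg[OF assms C_nonneg[OF that]] C_nonneg[OF that] by linarith
  then show ?thesis by (auto simp: round_invar_def pool_def)
qed

text \<open>Serves both phases. Earlier members of a pool still dominate because the unqueried set
  only shrinks; the new member dominates by \<open>best\<close>.\<close>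

lemma round_invar_add:
  assumes inv: "round_invar \<beta> Q0 Q b g"
    and i: "i \<in> E" "i \<notin> Q" "j < m" "w i j \<le> C j" "0 < b j (bkt i j)"
    and best: "\<And>i'. i' \<in> E \<Longrightarrow> i' \<notin> Q \<Longrightarrow> w i' j \<le> C j \<Longrightarrow> bkt i' j = bkt i j \<Longrightarrow> dominates j i i'"
  shows "round_invar \<beta> Q0 (insert i Q) (b(j := (b j)(bkt i j := b j (bkt i j) - w i j))) (g(i := j))"
    (is "round_invar _ _ ?Q ?b ?g")
proof -
  have sub: "Q0 \<subseteq> Q" "Q - Q0 \<subseteq> E" "i \<notin> Q0"
    using inv i by (auto simp: round_invar_def)
  have b: "\<And>j k. j < m \<Longrightarrow> b j k = \<beta> * C j - (\<Sum>i\<in>pool g (Q - Q0) j k. w i j) \<and> - C j \<le> b j k"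
    and dom: "\<And>i j a. i \<in> E \<Longrightarrow> i \<notin> Q \<Longrightarrow> j < m \<Longrightarrow> w i j \<le> C j \<Longrightarrow>
        a \<in> pool g (Q - Q0) j (bkt i j) \<Longrightarrow> dominates j a i"
    using inv unfolding round_invar_def by blast+
  \<comment> \<open>\<open>i\<close> is new, so redirecting \<open>g\<close> at \<open>i\<close>
    leaves all earlier charges in place.\<close>
  have pool_eq: "pool ?g (?Q - Q0) j' k =
      (if j' = j \<and> k = bkt i j then insert i (pool g (Q - Q0) j' k) else pool g (Q - Q0) j' k)" for j' k
    using i sub by (auto simp: pool_def)
  have "finite (pool g (Q - Q0) j k)" for j k
    using sub(2) finite_E by (auto simp: pool_def intro: finite_subset)
  moreover have "i \<notin> pool g (Q - Q0) j k" for j k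
    using i by (simp add: pool_def)
  ultimately have "?b j' k = \<beta> * C j' - (\<Sum>i\<in>pool ?g (?Q - Q0) j' k. w i j') \<and> - C j' \<le> ?b j' k"
    if "j' < m" for j' k
    using b[OF that, of k] i(4,5) unfolding pool_eq by (auto simp: pool_eq)
  moreover have "dominates j' a i'"
    if "i' \<in> E" "i' \<notin> ?Q" "j' < m" "w i' j' \<le> C j'" "a \<in> pool ?g (?Q - Q0) j' (bkt i' j')" for i' j' a
    using that dom[of i' j' a] best[of i'] unfolding pool_eq by (auto split: if_splits)
  moreover have "\<forall>i'\<in>?Q - Q0. ?g i' < m \<and> w i' (?g i') \<le> C (?g i')"
    using inv i by (auto simp: round_invar_def)
  ultimately show ?thesis
    using sub i unfolding round_invar_def by (intro conjI) blast+
qed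

text \<open>The choice is minimal among all eligible pairs. Unqueried fitting items of the same
  bucket of \<open>j\<close> share the positive budget of the chosen pair, hence are eligible and
  are dominated by it.\<close>

lemma round_invar_step1:
  assumes "round_invar \<beta> Q0 Q b g" "step1 E m C v w \<epsilon> M (Q, b) (Q', b')"
  shows "\<exists>g'. round_invar \<beta> Q0 Q' b' g'"
proof -
  obtain i j where ij: "elig1 E m C v w \<epsilon> M Q b i j"
    and min: "\<And>i' j'. elig1 E m C v w \<epsilon> M Q b i' j' \<Longrightarrow> w i j \<le> w i' j'"
    and eq: "Q' = insert i Q" "b' = b(j := (b j)(bkt i j := b j (bkt i j) - w i j))"
    using assms(2) by (auto simp: step1_def)
  have "dominates j i i'" if "i' \<in> E" "i' \<notin> Q" "w i' j \<le> C j" "bkt i' j = bkt i j" for i'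
    using min[of i' j] that ij by (auto simp: elig1_def dominates_def)
  then show ?thesis
    unfolding eq using ij round_invar_add[OF assms(1), of i j]
    by (intro exI[of _ "g(i := j)"]) (auto simp: elig1_def)
qed

lemma round_invar_step0:
  assumes "round_invar \<beta> Q0 Q b g" "step0 E m C v w \<epsilon> M (Q, b) (Q', b')"
  shows "\<exists>g'. round_invar \<beta> Q0 Q' b' g'"
proof -
  obtain i j where ij: "elig0 E m C v w \<epsilon> M Q b i j"
    and max: "\<And>i' j'. elig0 E m C v w \<epsilon> M Q b i' j' \<Longrightarrow> v i' j' / w i' j' \<le> v i j / w i j"
    and eq: "Q' = insert i Q" "b' = b(j := (b j)(0 := b j 0 - w i j))"
    using assms(2) by (auto simp: step0_def)
  have bkt: "bkt i j = 0" using ij by (simp add: elig0_def)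
  have "dominates j i i'" if "i' \<in> E" "i' \<notin> Q" "w i' j \<le> C j" "bkt i' j = bkt i j" for i'
    using max[of i' j] that ij by (auto simp: elig0_def dominates_def)
  then show ?thesis
    unfolding eq using ij round_invar_add[OF assms(1), of i j]
    by (intro exI[of _ "g(i := j)"]) (auto simp: elig0_def bkt)
qed

lemma round_invar_rtranclp:
  assumes "S\<^sup>*\<^sup>* x y" "\<exists>g. round_invar \<beta> Q0 (fst x) (snd x) g"
    and "\<And>Q b Q' b' g. round_invar \<beta> Q0 Q b g \<Longrightarrow> S (Q, b) (Q', b') \<Longrightarrow> \<exists>g'. round_invar \<beta> Q0 Q' b' g'"
  shows "\<exists>g. round_invar \<beta> Q0 (fst y) (snd y) g"
  using assms(1,2) by (induction rule: rtranclp_induct) (use assms(3) in force)+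

text \<open>The second phase leaves the budgets of the buckets k > 0 untouched, so that at the end
  of the round all pairs whose item was not queried face an exhausted budget.\<close>

lemma step0_preserves:
  assumes "(step0 E m C v w \<epsilon> M)\<^sup>*\<^sup>* x y"
  shows "fst x \<subseteq> fst y \<and> (\<forall>j k. k \<noteq> 0 \<longrightarrow> snd y j k = snd x j k)"
  using assms by (induction rule: rtranclp_induct) (auto simp: step0_def split: prod.splits)

text \<open>What remains of the invariant after the round once the budgets are eliminated:
  overshooting by at most one item bounds a pool from above, and an exhausted budget bounds it from
  below.\<close>

definition saturating ::
  "real \<Rightarrow> 'a set \<Rightarrow> 'a set \<Rightarrow> ('a \<Rightarrow> nat) \<Rightarrow> bool" where
  "saturating \<beta> Q0 Q g \<longleftrightarrow>
     Q0 \<subseteq> Q \<and> Q - Q0 \<subseteq> E \<and>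
     (\<forall>i\<in>Q - Q0. g i < m \<and> w i (g i) \<le> C (g i)) \<and>
     (\<forall>j<m. \<forall>k. (\<Sum>i\<in>pool g (Q - Q0) j k. w i j) \<le> (\<beta> + 1) * C j) \<and>
     (\<forall>i\<in>E - Q. \<forall>j<m. w i j \<le> C j \<longrightarrow>
        \<beta> * C j \<le> (\<Sum>a\<in>pool g (Q - Q0) j (bkt i j). w a j) \<and>
        (\<forall>a\<in>pool g (Q - Q0) j (bkt i j). dominates j a i))"

text \<open>An unqueried fitting item facing a positive budget would still be eligible, against the
  stopping condition of the phase responsible for its bucket.\<close>

lemma sparsifier_round_saturating:
  assumes "0 < p" "0 \<le> tau (\<epsilon>\<^sup>2)" "sparsifier_round E m C v w \<epsilon> p M Q0 Q"
  shows "\<exists>g. saturating (tau (\<epsilon>\<^sup>2) / p) Q0 Q g"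
proof -
  define \<beta> where "\<beta> = tau (\<epsilon>\<^sup>2) / p"
  have \<beta>: "0 \<le> \<beta>" using assms by (simp add: \<beta>_def)
  obtain Q1 b1 b2 where
    1: "(step1 E m C v w \<epsilon> M)\<^sup>*\<^sup>* (Q0, \<lambda>j k. \<beta> * C j) (Q1, b1)"
      "\<And>i j. \<not> elig1 E m C v w \<epsilon> M Q1 b1 i j" and
    2: "(step0 E m C v w \<epsilon> M)\<^sup>*\<^sup>* (Q1, b1) (Q, b2)"
      "\<And>i j. \<not> elig0 E m C v w \<epsilon> M Q b2 i j"
    using assms(3) by (auto simp: sparsifier_round_def \<beta>_def)
  have "\<exists>g. round_invar \<beta> Q0 Q1 b1 g"
    using round_invar_rtranclp[OF 1(1), of \<beta> Q0] round_invar_init[OF \<beta>] round_invar_step1 by auto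
  then obtain g where g: "round_invar \<beta> Q0 Q b2 g"
    using round_invar_rtranclp[OF 2(1), of \<beta> Q0] round_invar_step0 by auto
  have b2: "b2 j (bkt i j) \<le> 0" if "i \<in> E - Q" "j < m" "w i j \<le> C j" for i j
  proof (cases "bkt i j = 0")
    case True
    then show ?thesis using 2(2)[of i j] that by (auto simp: elig0_def)
  next
    case False
    have "i \<notin> Q1" "b2 j (bkt i j) = b1 j (bkt i j)"
      using step0_preserves[OF 2(1)] False that by auto
    then show ?thesis using 1(2)[of i j] that False by (auto simp: elig1_def)
  qed
  have b: "b2 j k = \<beta> * C j - (\<Sum>i\<in>pool g (Q - Q0) j k. w i j)" "- C j \<le> b2 j k"
    if "j < m" for j k
    using g that unfolding round_invar_def by blast+
  have "\<beta> * C j \<le> (\<Sum>a\<in>pool g (Q - Q0) j (bkt i j). w a j)"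
    if "i \<in> E - Q" "j < m" "w i j \<le> C j" for i j
    using b2[OF that] b(1)[OF that(2), of "bkt i j"] by simp
  moreover have "(\<Sum>i\<in>pool g (Q - Q0) j k. w i j) \<le> (\<beta> + 1) * C j" if "j < m" for j k
    using b[OF that, of k] by (simp add: algebra_simps)
  ultimately have "saturating \<beta> Q0 Q g"
    using g unfolding saturating_def round_invar_def by blast
  then show ?thesis unfolding \<beta>_def by blast
qed

lemma saturating_load:
  assumes "saturating \<beta> Q0 Q g" "j < m"
  shows "(\<Sum>i\<in>{i\<in>Q - Q0. g i = j}. w i j) \<le> real (bucketK \<epsilon> + 2) * ((\<beta> + 1) * C j)"
proof -
  have fin: "finite {i\<in>Q - Q0. g i = j}"
    using assms finite_E by (auto simp: saturating_def intro: finite_subset)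
  have "(\<Sum>i\<in>{i\<in>Q - Q0. g i = j}. w i j) =
      (\<Sum>k\<le>bucketK \<epsilon> + 1. \<Sum>i\<in>{i\<in>{i\<in>Q - Q0. g i = j}. bkt i j = k}. w i j)"
    by (rule sum.group[symmetric, OF fin]) (use bucket_le in auto)
  also have "\<dots> = (\<Sum>k\<le>bucketK \<epsilon> + 1. \<Sum>i\<in>pool g (Q - Q0) j k. w i j)"
    by (intro sum.cong) (auto simp: pool_def)
  also have "\<dots> \<le> (\<Sum>k\<le>bucketK \<epsilon> + 1. (\<beta> + 1) * C j)"
    using assms by (intro sum_mono) (auto simp: saturating_def)
  finally show ?thesis by simp
qed

end

section \<open>The value retained by one round\<close>

text \<open>The inner maximum in \<open>approx_sparsifier\<close>, with \<open>X\<close> in place of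
  \<open>Q \<inter> R\<close>.\<close>

definition restricted_opt ::
  "'a set \<Rightarrow> nat \<Rightarrow> (nat \<Rightarrow> real) \<Rightarrow> ('a \<Rightarrow> nat \<Rightarrow> real) \<Rightarrow> ('a \<Rightarrow> nat \<Rightarrow> real) \<Rightarrow> 'a set \<Rightarrow> real" where
  "restricted_opt E m C v w X = Max {gap_f E m C v w S | S. gap_feasible E m C w S \<and> S \<subseteq> X}"

text \<open>At \<open>x\<close> = \<epsilon>^2 this turns the failure probability 2 exp (- tau / 2)
  of the Chernoff bound into at most 2 \<epsilon>^2.\<close>

lemma tau_ge:
  assumes "0 < x" "x \<le> 1"
  shows "2 * ln (1 / x) \<le> tau x"
proof -
  have L: "0 \<le> ln (1 / x)" using assms by simp
  then have "ln (1 / x) \<le> sqrt ((ln (1 / x))\<^sup>2 + 2 * ln (1 / x))"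
    by (intro real_le_rsqrt) simp
  then show ?thesis by (simp add: tau_def)
qed

context gap
begin

text \<open>Disjoint item sets that fit into their knapsacks form an assignment; its item set is
  feasible and competes in the maximum.\<close>

lemma restricted_opt_ge:
  assumes "X \<subseteq> E" and B: "\<And>j. j < m \<Longrightarrow> B j \<subseteq> X"
    and disj: "\<And>i j j'. j < m \<Longrightarrow> j' < m \<Longrightarrow> i \<in> B j \<Longrightarrow> i \<in> B j' \<Longrightarrow> j = j'"
    and weight: "\<And>j. j < m \<Longrightarrow> (\<Sum>i\<in>B j. w i j) \<le> C j"
  shows "(\<Sum>j<m. \<Sum>i\<in>B j. v i j) \<le> restricted_opt E m C v w X"
proof -
  define A where "A = prod.swap ` (SIGMA j:{..<m}. B j)"
  have fin: "finite (B j)" if "j < m" for j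
    using B[OF that] assms(1) finite_E by (meson finite_subset)
  have "{q \<in> A. snd q = j} = (\<lambda>i. (i, j)) ` B j" if "j < m" for j
    using that by (auto simp: A_def image_iff)
  then have "\<forall>j<m. (\<Sum>q\<in>{q \<in> A. snd q = j}. w (fst q) (snd q)) \<le> C j"
    using weight by (simp add: sum.reindex inj_on_def)
  moreover have "A \<subseteq> E \<times> {..<m}"
    using B assms(1) unfolding A_def by fastforce
  moreover have "\<forall>i j j'. (i, j) \<in> A \<longrightarrow> (i, j') \<in> A \<longrightarrow> j = j'"
    using disj unfolding A_def by auto
  ultimately have "is_assignment E m C w A"
    by (simp add: is_assignment_def)
  moreover have "fst ` A \<subseteq> X"
    using B unfolding A_def by fastforce
  moreover have "assign_value v A = (\<Sum>j<m. \<Sum>i\<in>B j. v i j)"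
    using fin by (simp add: assign_value_def A_def sum.reindex sum.Sigma case_prod_unfold)
  ultimately have A: "is_assignment E m C w A" "fst ` A \<subseteq> X"
    "assign_value v A = (\<Sum>j<m. \<Sum>i\<in>B j. v i j)" by auto
  have "{A. is_assignment E m C w A} \<subseteq> Pow (E \<times> {..<m})"
    by (auto simp: is_assignment_def)
  then have finA: "finite {A. is_assignment E m C w A}"
    using finite_E by (auto intro: finite_subset)
  have "assign_value v A \<le> gap_f E m C v w (fst ` A)"
    unfolding gap_f_def using A(1) finA by (intro Max_ge) auto
  also have "\<dots> \<le> restricted_opt E m C v w X"
    unfolding restricted_opt_def
  proof (intro Max_ge)
    have "{gap_f E m C v w S | S. gap_feasible E m C w S \<and> S \<subseteq> X} \<subseteq> gap_f E m C v w ` Pow E"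
      using assms(1) by auto
    then show "finite {gap_f E m C v w S | S. gap_feasible E m C w S \<and> S \<subseteq> X}"
      by (rule finite_subset) (simp add: finite_E)
    show "gap_f E m C v w (fst ` A) \<in> {gap_f E m C v w S | S. gap_feasible E m C w S \<and> S \<subseteq> X}"
      using A by (auto simp: gap_feasible_def)
  qed
  finally show ?thesis using A(3) by simp
qed

end

section \<open>The optimal assignment, knapsack by knapsack\<close>

locale gap_opt = gap E m C v w \<epsilon> M
  for E :: "'a set" and m C v w \<epsilon> M +
  fixes p :: real and opt :: "'a set \<Rightarrow> ('a \<times> nat) set"
  assumes \<epsilon>: "0 < \<epsilon>" "\<epsilon> < 1 / 6" and p: "0 < p" "p \<le> 1"
    and opt: "opt_rule E m C v w opt"
    and M_eq: "M = (\<lambda>j. ER E p (\<lambda>R. assign_value_in v (opt R) j))"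
begin

definition knapsack :: "'a set \<Rightarrow> nat \<Rightarrow> 'a set" where
  "knapsack R j = {i. (i, j) \<in> opt R}"

definition val :: "nat \<Rightarrow> 'a set \<Rightarrow> real" where
  "val j X = (\<Sum>i\<in>X. v i j)"

definition wgt :: "nat \<Rightarrow> 'a set \<Rightarrow> real" where
  "wgt j X = (\<Sum>i\<in>X. w i j)"

lemma opt_assignment: "R \<subseteq> E \<Longrightarrow> is_assignment E m C w (opt R)"
  using opt by (simp add: opt_rule_def)

lemma knapsack_subset:
  assumes "R \<subseteq> E"
  shows "knapsack R j \<subseteq> R"
proof -
  have "fst ` opt R \<subseteq> R" using opt assms by (simp add: opt_rule_def)
  then show ?thesis by (auto simp: knapsack_def)
qed

lemma knapsack_E:
  assumes "R \<subseteq> E"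
  shows "knapsack R j \<subseteq> E" "finite (knapsack R j)"
proof -
  show "knapsack R j \<subseteq> E"
    using knapsack_subset[OF assms, of j] assms by (rule order_trans)
  then show "finite (knapsack R j)"
    using finite_E by (rule finite_subset)
qed

lemma knapsack_disjoint: "R \<subseteq> E \<Longrightarrow> i \<in> knapsack R j \<Longrightarrow> i \<in> knapsack R j' \<Longrightarrow> j = j'"
  using opt_assignment unfolding is_assignment_def knapsack_def by blast

lemma opt_in: "{q \<in> opt R. snd q = j} = (\<lambda>i. (i, j)) ` knapsack R j"
  by (auto simp: knapsack_def)

lemma wgt_knapsack_le: "R \<subseteq> E \<Longrightarrow> j < m \<Longrightarrow> wgt j (knapsack R j) \<le> C j"
  using opt_assignment[of R] unfolding is_assignment_def
  by (auto simp: opt_in wgt_def sum.reindex inj_on_def)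

lemma assign_value_in_opt: "assign_value_in v (opt R) j = val j (knapsack R j)"
  by (simp add: assign_value_in_def opt_in val_def sum.reindex inj_on_def)

lemma gap_f_eq:
  assumes "R \<subseteq> E"
  shows "gap_f E m C v w R = (\<Sum>j<m. val j (knapsack R j))"
proof -
  have sub: "opt R \<subseteq> E \<times> {..<m}"
    using opt_assignment[OF assms] by (simp add: is_assignment_def)
  then have "finite (opt R)"
    using finite_E finite_subset by blast
  then have "assign_value v (opt R) = (\<Sum>j<m. assign_value_in v (opt R) j)"
    unfolding assign_value_def assign_value_in_def using sub by (intro sum.group[symmetric]) auto
  then show ?thesis
    using assms opt by (simp add: opt_rule_def assign_value_in_opt)
qed

lemma M_val: "M j = ER E p (\<lambda>R. val j (knapsack R j))"
  by (simp add: M_eq assign_value_in_opt)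

lemma val_nonneg: "X \<subseteq> E \<Longrightarrow> j < m \<Longrightarrow> 0 \<le> val j X"
  using v_nonneg unfolding val_def by (intro sum_nonneg) blast

lemma wgt_mono: "X \<subseteq> Y \<Longrightarrow> Y \<subseteq> E \<Longrightarrow> j < m \<Longrightarrow> wgt j X \<le> wgt j Y"
  unfolding wgt_def by (rule sum_mono2) (auto intro: finite_subset[OF _ finite_E] less_imp_le[OF w_pos])

lemma M_nonneg:
  assumes "j < m"
  shows "0 \<le> M j"
proof -
  have "ER E p (\<lambda>_. 0) \<le> M j"
    unfolding M_val
  proof (rule ER_mono)
    fix R assume "R \<subseteq> E"
    then show "0 \<le> val j (knapsack R j)"
      using knapsack_subset[of R j] assms by (intro val_nonneg) auto
  qed (use p in auto)
  then show ?thesis by (simp add: ER_const[OF finite_E])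
qed

lemma ER_gap_f: "ER E p (gap_f E m C v w) = (\<Sum>j<m. M j)"
proof -
  have "ER E p (gap_f E m C v w) = ER E p (\<lambda>R. \<Sum>j<m. val j (knapsack R j))"
    by (rule ER_cong) (rule gap_f_eq)
  then show ?thesis by (simp only: ER_sum M_val)
qed

text \<open>Items of the top bucket are so valuable that a single one of them, packed alone,
  makes up for everything the optimum is expected to put into the knapsack.\<close>

lemma top_bucket_value:
  assumes "bkt i j = bucketK \<epsilon> + 1" "j < m"
  shows "2 * M j \<le> v i j"
proof -
  \<comment> \<open>By \<open>bucketK_growth\<close> the top threshold is at least
    \<open>M j / \<epsilon>\<close>, and 1 / \<epsilon> exceeds 6.\<close>
  have "2 \<le> \<epsilon>\<^sup>2 * (1 / \<epsilon> ^ 3)"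
    using \<epsilon> by (simp add: field_simps power2_eq_square power3_eq_cube)
  also have "\<dots> \<le> \<epsilon>\<^sup>2 * (1 + \<epsilon>\<^sup>2) ^ bucketK \<epsilon>"
    using bucketK_growth[OF \<epsilon>] by (intro mult_left_mono) auto
  finally have "2 * M j \<le> \<epsilon>\<^sup>2 * (1 + \<epsilon>\<^sup>2) ^ bucketK \<epsilon> * M j"
    using M_nonneg[OF assms(2)] by (intro mult_right_mono)
  also have "\<dots> < v i j" by (rule bucket_top[where M = M, OF assms(1)])
  finally show ?thesis by simp
qed

end

section \<open>Replacements drawn from the items \<open>T\<close> of one round\<close>

locale gap_round = gap_opt E m C v w \<epsilon> M p opt
  for E :: "'a set" and m C v w \<epsilon> M p opt +
  fixes Q0 Q1 Q :: "'a set" and g :: "'a \<Rightarrow> nat"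
  assumes saturating: "saturating (tau (\<epsilon>\<^sup>2) / p) Q0 Q1 g"
    and Q: "Q1 \<subseteq> Q" "Q \<subseteq> E"
begin

abbreviation T :: "'a set" where "T \<equiv> Q1 - Q0"

lemma T_sub: "T \<subseteq> Q" "T \<subseteq> E"
  using Q by auto

text \<open>An item outside the final \<open>Q\<close> is also unqueried at the end of this round,
  so \<open>saturating\<close> speaks about it.\<close>

lemma pool_dominates:
  assumes "i \<in> E - Q" "j < m" "w i j \<le> C j" "a \<in> pool g T j (bkt i j)"
  shows "dominates j a i"
  using assms saturating Q unfolding saturating_def by blast

lemma pool_weight:
  assumes "i \<in> E - Q" "j < m" "w i j \<le> C j"
  shows "tau (\<epsilon>\<^sup>2) / p * C j \<le> wgt j (pool g T j (bkt i j))"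
  using assms saturating Q unfolding saturating_def wgt_def by blast

lemma pool_sub: "pool g T j k \<subseteq> T"
  by (auto simp: pool_def)

lemma pool_fits: "a \<in> pool g T j k \<Longrightarrow> w a j \<le> C j"
  using saturating by (auto simp: saturating_def pool_def)

text \<open>The event that the active part of a pool suffices for replacement: whatever the optimum
  puts into knapsack \<open>j\<close> weighs at most \<open>C j\<close>.\<close>

definition rich :: "nat \<Rightarrow> nat \<Rightarrow> 'a set \<Rightarrow> bool" where
  "rich j k R \<longleftrightarrow> C j \<le> wgt j (pool g T j k \<inter> R)"

text \<open>This depends on \<open>Q\<close> but not on the realization, so the case distinction can
  be made before taking expectations.\<close>

definition open_top :: "nat \<Rightarrow> bool" where
  "open_top j \<longleftrightarrow> (\<exists>i\<in>E - Q. w i j \<le> C j \<and> bkt i j = bucketK \<epsilon> + 1)"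

definition lost :: "'a set \<Rightarrow> nat \<Rightarrow> nat \<Rightarrow> 'a set" where
  "lost R j k = {i \<in> knapsack R j - Q. bkt i j = k}"

text \<open>The item \<open>i\<close> witnesses that its bucket was saturated, so the Chernoff bound
  applies to the pool.\<close>

lemma ER_rich:
  assumes "i \<in> E - Q" "j < m" "w i j \<le> C j"
  shows "1 - 2 * \<epsilon>\<^sup>2 \<le> ER T p (\<lambda>R. of_bool (rich j (bkt i j) R))"
proof -
  \<comment> \<open>The Chernoff bound measures weights in units of the capacity, which is positive
    because an item of positive weight fits.\<close>
  have "0 < C j" using w_pos[of i j] assms by simp
  have "2 * ln (1 / \<epsilon>\<^sup>2) \<le> tau (\<epsilon>\<^sup>2)"
    using \<epsilon> by (intro tau_ge) (auto simp: power_le_one)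
  then have "exp (- (tau (\<epsilon>\<^sup>2) / 2)) \<le> exp (- ln (1 / \<epsilon>\<^sup>2))" by simp
  also have "\<dots> = \<epsilon>\<^sup>2" using \<epsilon> by (simp add: exp_minus)
  finally have "1 - 2 * \<epsilon>\<^sup>2 \<le> 1 - 2 * exp (- (tau (\<epsilon>\<^sup>2) / 2))" by simp
  also have "\<dots> \<le> ER T p (\<lambda>R. of_bool (rich j (bkt i j) R))"
    unfolding rich_def wgt_def
  proof (rule ER_active_weight_ge[OF _ pool_sub p \<open>0 < C j\<close>])
    show "finite T" using T_sub finite_E finite_subset by blast
    show "0 \<le> w a j \<and> w a j \<le> C j" if "a \<in> pool g T j (bkt i j)" for a
      using that pool_fits[OF that] subsetD[OF pool_sub that] T_sub w_pos[of a j] \<open>j < m\<close>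
      by (auto intro: less_imp_le)
  qed (use pool_weight[OF assms] in \<open>simp add: wgt_def\<close>)
  finally show ?thesis .
qed

text \<open>One form for all buckets: the quotient pays for replacing by lighter items
  (\<open>k > 0\<close>), the additive term for replacing by denser ones (\<open>k = 0\<close>). If
  the pool is not rich or nothing was lost, the empty set serves.\<close>

lemma replace_bucket:
  assumes R: "R \<subseteq> E" and j: "j < m" and k: "k \<le> bucketK \<epsilon>"
  shows "\<exists>B. B \<subseteq> pool g T j k \<inter> R' \<and> wgt j B \<le> wgt j (lost R j k) \<and>
    of_bool (rich j k R') * (val j (lost R j k) / (1 + \<epsilon>\<^sup>2)) \<le> val j B + of_bool (k = 0) * (\<epsilon>\<^sup>2 * M j)"
proof (cases "rich j k R' \<and> lost R j k \<noteq> {}")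
  case False
  have "lost R j k \<subseteq> E"
    using knapsack_subset[OF R] R by (auto simp: lost_def)
  then have "0 \<le> wgt j (lost R j k)"
    using wgt_mono[of "{}" "lost R j k" j] j by (simp add: wgt_def)
  moreover have "val j {} = 0" "wgt j {} = 0" by (simp_all add: val_def wgt_def)
  moreover have "rich j k R' \<Longrightarrow> lost R j k = {}" using False by blast
  ultimately show ?thesis
    using M_nonneg[OF j] by (intro exI[of _ "{}"]) (auto simp: val_def)
next
  case True
  have sub: "lost R j k \<subseteq> E - Q"
    using knapsack_subset[OF R] R by (auto simp: lost_def)
  then have subE: "lost R j k \<subseteq> E" by blast
  have knapE: "knapsack R j \<subseteq> E" using knapsack_subset[OF R] R by blast
  have fin: "finite (lost R j k)" "finite (pool g T j k \<inter> R')"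
    using subE pool_sub T_sub finite_E by (meson finite_subset finite_Int)+
  have le_C: "wgt j (lost R j k) \<le> C j"
    using wgt_mono[of "lost R j k" "knapsack R j" j] knapE wgt_knapsack_le[OF R j] j
    by (force simp: lost_def)
  have fits: "w i j \<le> C j" if "i \<in> lost R j k" for i
    using wgt_mono[of "{i}" "lost R j k" j] that subE j le_C by (auto simp: wgt_def)
  have rich: "C j \<le> wgt j (pool g T j k \<inter> R')"
    using True by (simp add: rich_def)
  have dom: "dominates j a i" if "a \<in> pool g T j k \<inter> R'" "i \<in> lost R j k" for a i
    using pool_dominates[of i j a] that sub fits j by (auto simp: lost_def)
  have lost_bkt: "i \<in> lost R j k \<Longrightarrow> bkt i j = k" for i
    by (simp add: lost_def)
  have pool_bkt: "a \<in> pool g T j k \<inter> R' \<Longrightarrow> bkt a j = k \<and> a \<in> E" for a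
    using T_sub by (auto simp: pool_def)
  show ?thesis
  proof (cases "k = 0")
    case k0: True
    obtain B where B: "B \<subseteq> pool g T j k \<inter> R'" "wgt j B \<le> wgt j (lost R j k)"
      "val j (lost R j k) \<le> val j B + \<epsilon>\<^sup>2 * M j"
    proof -
      have "\<And>a i. a \<in> pool g T j k \<inter> R' \<Longrightarrow> i \<in> lost R j k \<Longrightarrow> v i j / w i j \<le> v a j / w a j"
        using dom lost_bkt k0 by (force simp: dominates_def)
      moreover have "\<And>a. a \<in> pool g T j k \<inter> R' \<Longrightarrow> v a j \<le> \<epsilon>\<^sup>2 * M j"
        using pool_bkt k0 by (intro bucket_eq_0) auto
      moreover have "\<And>i. i \<in> lost R j k \<Longrightarrow> 0 < w i j \<and> 0 \<le> v i j"
        using subE w_pos v_nonneg j by blast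
      moreover have "\<And>a. a \<in> pool g T j k \<inter> R' \<Longrightarrow> 0 < w a j"
        using pool_bkt w_pos j by blast
      moreover have "0 \<le> \<epsilon>\<^sup>2 * M j"
        using M_nonneg[OF j] by simp
      ultimately show thesis
        using replace_by_denser[OF fin, where wt = "\<lambda>i. w i j" and vl = "\<lambda>i. v i j"
            and c = "C j" and \<mu> = "\<epsilon>\<^sup>2 * M j"] le_C rich that
        unfolding val_def wgt_def by blast
    qed
    have "val j (lost R j k) / (1 + \<epsilon>\<^sup>2) \<le> val j (lost R j k)"
      using val_nonneg[OF subE j] by (simp add: divide_le_eq mult_le_cancel_left1 add_pos_nonneg)
    then show ?thesis using B True k0 by (intro exI[of _ B]) auto
  next
    case k0: False
    obtain B where B: "B \<subseteq> pool g T j k \<inter> R'" "wgt j B \<le> wgt j (lost R j k)"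
      "val j (lost R j k) \<le> (1 + \<epsilon>\<^sup>2) * val j B"
    proof -
      have "\<And>a i. a \<in> pool g T j k \<inter> R' \<Longrightarrow> i \<in> lost R j k \<Longrightarrow> w a j \<le> w i j"
        using dom lost_bkt k0 by (force simp: dominates_def)
      moreover have "\<And>a i. a \<in> pool g T j k \<inter> R' \<Longrightarrow> i \<in> lost R j k \<Longrightarrow> v i j \<le> (1 + \<epsilon>\<^sup>2) * v a j"
        using pool_bkt lost_bkt k0 k by (intro bucket_same[of \<epsilon> M v _ j k]) auto
      moreover have "\<And>i. i \<in> lost R j k \<Longrightarrow> 0 < w i j"
        using subE w_pos j by blast
      ultimately show thesis
        using replace_by_lighter[OF fin, where wt = "\<lambda>i. w i j" and vl = "\<lambda>i. v i j"
            and c = "C j" and \<gamma> = "1 + \<epsilon>\<^sup>2"] le_C rich that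
        unfolding val_def wgt_def by blast
    qed
    then have "val j (lost R j k) / (1 + \<epsilon>\<^sup>2) \<le> val j B"
      by (simp add: divide_le_eq mult.commute add_pos_nonneg)
    then show ?thesis using B True k0 by (intro exI[of _ B]) auto
  qed
qed

text \<open>\<open>R\<close> determines the optimum and thus what is kept and what is lost;
  \<open>R'\<close> determines which replacements are active.\<close>

definition knapsack_bound :: "'a set \<Rightarrow> 'a set \<Rightarrow> nat \<Rightarrow> real" where
  "knapsack_bound R R' j =
     (if open_top j then of_bool (rich j (bucketK \<epsilon> + 1) R') * (2 * M j)
      else val j (knapsack R j \<inter> (Q - T)) +
        (\<Sum>k\<le>bucketK \<epsilon>. of_bool (rich j k R') * (val j (lost R j k) / (1 + \<epsilon>\<^sup>2))) - \<epsilon>\<^sup>2 * M j)"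

text \<open>Items of the optimum fit into their knapsack, so without an open top none of the
  unqueried ones lies in bucket \<open>bucketK \<epsilon> + 1\<close>.\<close>

lemma sum_lost:
  assumes R: "R \<subseteq> E" and j: "j < m" "\<not> open_top j"
  shows "(\<Sum>k\<le>bucketK \<epsilon>. \<Sum>i\<in>lost R j k. h i) = (\<Sum>i\<in>knapsack R j - Q. h i)"
proof -
  have knapE: "knapsack R j \<subseteq> E" using knapsack_subset[OF R] R by blast
  have "bkt i j \<le> bucketK \<epsilon>" if "i \<in> knapsack R j - Q" for i
  proof -
    have "w i j \<le> C j"
      using wgt_mono[of "{i}" "knapsack R j" j] that knapE j wgt_knapsack_le[OF R j(1)]
      by (auto simp: wgt_def)
    then have "bkt i j \<noteq> bucketK \<epsilon> + 1"
      using that knapE j(2) by (auto simp: open_top_def)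
    then show ?thesis using bucket_le[of \<epsilon> M v i j] by linarith
  qed
  moreover have "finite (knapsack R j - Q)"
    using knapE finite_E finite_subset by blast
  ultimately show ?thesis
    unfolding lost_def by (intro sum.group) auto
qed

text \<open>The second inclusion makes the sets of different knapsacks disjoint: outside
  \<open>T\<close> they follow the optimum, inside \<open>T\<close> the map \<open>g\<close>. Kept
  items stay active because \<open>R'\<close> agrees with \<open>R\<close> at least on them.\<close>

lemma knapsack_replacement:
  assumes R: "R \<subseteq> E" and j: "j < m" and R': "R - T \<subseteq> R'"
  shows "\<exists>B. B \<subseteq> Q \<inter> R' \<and> B \<subseteq> (knapsack R j - T) \<union> {i\<in>T. g i = j} \<and> wgt j B \<le> C j \<and>
    knapsack_bound R R' j \<le> val j B"
proof (cases "open_top j")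
  case True
  then obtain i where "i \<in> E" "w i j \<le> C j" by (auto simp: open_top_def)
  then have C: "0 < C j" using w_pos[of i j] j by simp
  show ?thesis
  proof (cases "rich j (bucketK \<epsilon> + 1) R'")
    case rich: True
    \<comment> \<open>Capacity is positive, so a rich pool has an active item; it is packed
      alone.\<close>
    then have "pool g T j (bucketK \<epsilon> + 1) \<inter> R' \<noteq> {}"
      using C by (auto simp: rich_def wgt_def)
    then obtain a where a: "a \<in> pool g T j (bucketK \<epsilon> + 1)" "a \<in> R'" by blast
    then have "bkt a j = bucketK \<epsilon> + 1" "a \<in> T" "g a = j" by (auto simp: pool_def)
    then show ?thesis
      using a T_sub pool_fits[OF a(1)] top_bucket_value[of a j] True rich j
      by (intro exI[of _ "{a}"]) (auto simp: val_def wgt_def knapsack_bound_def)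
  next
    case False
    then show ?thesis using True C by (intro exI[of _ "{}"]) (auto simp: val_def wgt_def knapsack_bound_def)
  qed
next
  case False
  define keep where "keep = knapsack R j \<inter> (Q - T)"
  have knap: "knapsack R j \<subseteq> R" "knapsack R j \<subseteq> E" using knapsack_subset[OF R] R by auto
  define repl where "repl k B \<longleftrightarrow> B \<subseteq> pool g T j k \<inter> R' \<and> wgt j B \<le> wgt j (lost R j k) \<and>
      of_bool (rich j k R') * (val j (lost R j k) / (1 + \<epsilon>\<^sup>2)) \<le> val j B + of_bool (k = 0) * (\<epsilon>\<^sup>2 * M j)" for k B
  have "\<exists>B. repl k B" if "k \<le> bucketK \<epsilon>" for k
    using replace_bucket[OF R j that] unfolding repl_def .
  then obtain B where "\<And>k. k \<le> bucketK \<epsilon> \<Longrightarrow> repl k (B k)" by metis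
  then have B: "B k \<subseteq> pool g T j k \<inter> R' \<and> wgt j (B k) \<le> wgt j (lost R j k) \<and>
      of_bool (rich j k R') * (val j (lost R j k) / (1 + \<epsilon>\<^sup>2)) \<le> val j (B k) + of_bool (k = 0) * (\<epsilon>\<^sup>2 * M j)"
    if "k \<le> bucketK \<epsilon>" for k
    using that unfolding repl_def by blast
  have B_pool: "B k \<subseteq> pool g T j k" "B k \<subseteq> R'" "B k \<subseteq> T" if "k \<le> bucketK \<epsilon>" for k
    using B[OF that] pool_sub by blast+
  have fin: "finite keep" "finite (knapsack R j)" "\<And>k. k \<le> bucketK \<epsilon> \<Longrightarrow> finite (B k)"
    using knap B_pool T_sub finite_E unfolding keep_def by (meson finite_subset finite_Int)+
  define U where "U = keep \<union> (\<Union>k\<le>bucketK \<epsilon>. B k)"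
  \<comment> \<open>Kept items avoid \<open>T\<close>, and replacements for different buckets come
    from different pools.\<close>
  have sum_U: "(\<Sum>i\<in>U. h i) = (\<Sum>i\<in>keep. h i) + (\<Sum>k\<le>bucketK \<epsilon>. \<Sum>i\<in>B k. h i)" for h :: "'a \<Rightarrow> real"
  proof -
    have "keep \<inter> (\<Union>k\<le>bucketK \<epsilon>. B k) = {}"
      using B_pool(3) unfolding keep_def by blast
    moreover have "(\<Sum>i\<in>(\<Union>k\<le>bucketK \<epsilon>. B k). h i) = (\<Sum>k\<le>bucketK \<epsilon>. \<Sum>i\<in>B k. h i)"
      using fin(3) B_pool(1) by (intro sum.UNION_disjoint) (auto simp: pool_def, blast)
    ultimately show ?thesis
      unfolding U_def using fin by (subst sum.union_disjoint) auto
  qed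
  have "wgt j U \<le> wgt j keep + (\<Sum>k\<le>bucketK \<epsilon>. wgt j (lost R j k))"
    using B unfolding wgt_def sum_U by (intro add_left_mono sum_mono) auto
  also have "\<dots> = wgt j keep + wgt j (knapsack R j - Q)"
    unfolding wgt_def by (simp add: sum_lost[OF R j False])
  also have "\<dots> = wgt j (keep \<union> (knapsack R j - Q))"
    unfolding wgt_def by (rule sum.union_disjoint[symmetric]) (use fin in \<open>auto simp: keep_def\<close>)
  also have "\<dots> \<le> C j"
    using wgt_mono[of "keep \<union> (knapsack R j - Q)" "knapsack R j" j] wgt_knapsack_le[OF R j] knap j
    by (force simp: keep_def)
  finally have "wgt j U \<le> C j" .
  moreover have "knapsack_bound R R' j \<le> val j U"
  proof -
    have "(\<Sum>k\<le>bucketK \<epsilon>. of_bool (rich j k R') * (val j (lost R j k) / (1 + \<epsilon>\<^sup>2))) \<le>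
        (\<Sum>k\<le>bucketK \<epsilon>. val j (B k) + of_bool (k = 0) * (\<epsilon>\<^sup>2 * M j))"
      using B by (intro sum_mono) auto
    \<comment> \<open>The additive loss occurs once, for bucket 0.\<close>
    also have "\<dots> = (\<Sum>k\<le>bucketK \<epsilon>. val j (B k)) + \<epsilon>\<^sup>2 * M j"
      by (simp add: sum.distrib of_bool_def if_distrib[of "\<lambda>x. x * _"] sum.delta cong: if_cong)
    finally show ?thesis
      using False unfolding knapsack_bound_def val_def sum_U keep_def by simp
  qed
  moreover have "U \<subseteq> Q \<inter> R'" "U \<subseteq> (knapsack R j - T) \<union> {i\<in>T. g i = j}"
    using B_pool T_sub knap R' unfolding U_def keep_def pool_def by blast+
  ultimately show ?thesis by blast
qed

lemma restricted_opt_ge_bound: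
  assumes R: "R \<subseteq> E" and R': "R' \<subseteq> E" "R - T \<subseteq> R'"
  shows "(\<Sum>j<m. knapsack_bound R R' j) \<le> restricted_opt E m C v w (Q \<inter> R')"
proof -
  define repl where "repl j B \<longleftrightarrow> B \<subseteq> Q \<inter> R' \<and> B \<subseteq> (knapsack R j - T) \<union> {i\<in>T. g i = j} \<and>
      wgt j B \<le> C j \<and> knapsack_bound R R' j \<le> val j B" for j B
  have "\<exists>B. repl j B" if "j < m" for j
    using knapsack_replacement[OF R that R'(2)] unfolding repl_def .
  then obtain B where "\<And>j. j < m \<Longrightarrow> repl j (B j)" by metis
  then have B: "B j \<subseteq> Q \<inter> R' \<and> B j \<subseteq> (knapsack R j - T) \<union> {i\<in>T. g i = j} \<and>
      wgt j (B j) \<le> C j \<and> knapsack_bound R R' j \<le> val j (B j)" if "j < m" for j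
    using that unfolding repl_def by blast
  have "(\<Sum>j<m. knapsack_bound R R' j) \<le> (\<Sum>j<m. val j (B j))"
    using B by (intro sum_mono) auto
  also have "\<dots> \<le> restricted_opt E m C v w (Q \<inter> R')"
    unfolding val_def
  proof (rule restricted_opt_ge)
    fix i j j' assume "j < m" "j' < m" "i \<in> B j" "i \<in> B j'"
    then show "j = j'"
      using B[of j] B[of j'] knapsack_disjoint[OF R, of i j j'] by blast
  qed (use B R' in \<open>auto simp: wgt_def\<close>)
  finally show ?thesis .
qed

end

section \<open>Expectation over the resampled round\<close>

context gap_round
begin

text \<open>A lower bound, given \<open>R\<close>, for \<open>knapsack_bound\<close> averaged over
  the resampled round. Of the 3 \<epsilon>^2, two cover pools that are not rich and one covers the
  bucket width; the last term is the additive loss of bucket 0.\<close>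

definition retained :: "'a set \<Rightarrow> nat \<Rightarrow> real" where
  "retained R j =
     (if open_top j then M j
      else (1 - 3 * \<epsilon>\<^sup>2) * val j (knapsack R j) - val j (knapsack R j \<inter> T) - \<epsilon>\<^sup>2 * M j)"

lemma eps_sq: "\<epsilon>\<^sup>2 \<le> \<epsilon> / 6"
  using \<epsilon> by (simp add: power2_eq_square)

text \<open>\<open>X\<close> misses \<open>T\<close>, so whether a pool is rich depends on
  \<open>Y\<close> alone, while \<open>R\<close> fixes all values. By linearity the expectation
  falls on the indicators, which \<open>ER_rich\<close> bounds.\<close>

lemma ER_knapsack_bound:
  assumes R: "R \<subseteq> E" and j: "j < m" and X: "X \<inter> T = {}"
  shows "retained R j \<le> ER T p (\<lambda>Y. knapsack_bound R (X \<union> Y) j)"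
proof -
  have finT: "finite T" using T_sub finite_E finite_subset by blast
  have "pool g T j k \<inter> (X \<union> Y) = pool g T j k \<inter> Y" for k Y
    using X pool_sub by blast
  then have rich: "rich j k (X \<union> Y) = rich j k Y" for k Y
    by (simp add: rich_def)
  show ?thesis
  proof (cases "open_top j")
    case True
    then obtain i where i: "i \<in> E - Q" "w i j \<le> C j" "bkt i j = bucketK \<epsilon> + 1"
      by (auto simp: open_top_def)
    \<comment> \<open>The factor 2 from \<open>top_bucket_value\<close> absorbs the failure
      probability, as 2 \<epsilon>^2 is below 1/2.\<close>
    have "1 * M j \<le> (1 - 2 * \<epsilon>\<^sup>2) * 2 * M j"
      using eps_sq \<epsilon> M_nonneg[OF j] by (intro mult_right_mono) auto
    then have "M j \<le> (1 - 2 * \<epsilon>\<^sup>2) * (2 * M j)"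
      by (simp only: mult_1_left mult.assoc)
    also have "\<dots> \<le> ER T p (\<lambda>Y. of_bool (rich j (bucketK \<epsilon> + 1) Y)) * (2 * M j)"
      using ER_rich[OF i(1) j i(2)] M_nonneg[OF j] unfolding i(3) by (intro mult_right_mono) auto
    also have "\<dots> = ER T p (\<lambda>Y. knapsack_bound R (X \<union> Y) j)"
      using True by (simp only: knapsack_bound_def rich if_True ER_cmult_right)
    finally show ?thesis using True by (simp add: retained_def)
  next
    case False
    have knap: "knapsack R j \<subseteq> E" "finite (knapsack R j)"
      by (rule knapsack_E[OF R])+
    define a where "a = val j (knapsack R j \<inter> (Q - T))"
    define b where "b = val j (knapsack R j - Q)"
    define l where "l = val j (knapsack R j \<inter> T)"
    have nonneg: "0 \<le> a" "0 \<le> b" "0 \<le> l"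
      using knap unfolding a_def b_def l_def by (auto intro!: val_nonneg j)
    have "knapsack R j = (knapsack R j \<inter> (Q - T)) \<union> (knapsack R j - Q) \<union> (knapsack R j \<inter> T)"
      using T_sub by blast
    then have "val j (knapsack R j) = val j ((knapsack R j \<inter> (Q - T)) \<union> (knapsack R j - Q) \<union> (knapsack R j \<inter> T))"
      by simp
    also have "\<dots> = val j ((knapsack R j \<inter> (Q - T)) \<union> (knapsack R j - Q)) + l"
      unfolding val_def l_def using knap T_sub by (intro sum.union_disjoint) auto
    also have "val j ((knapsack R j \<inter> (Q - T)) \<union> (knapsack R j - Q)) = a + b"
      unfolding val_def a_def b_def using knap by (intro sum.union_disjoint) auto
    finally have total: "val j (knapsack R j) = a + b + l" .
    \<comment> \<open>If nothing is lost both sides vanish; otherwise a lost item is the witness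
      that \<open>ER_rich\<close> asks for.\<close>
    have each: "(1 - 2 * \<epsilon>\<^sup>2) * (val j (lost R j k) / (1 + \<epsilon>\<^sup>2)) \<le>
        ER T p (\<lambda>Y. of_bool (rich j k Y)) * (val j (lost R j k) / (1 + \<epsilon>\<^sup>2))" for k
    proof (cases "lost R j k = {}")
      case False
      then obtain i where i: "i \<in> knapsack R j" "i \<notin> Q" "bkt i j = k"
        by (auto simp: lost_def)
      have "w i j \<le> C j"
        using wgt_mono[of "{i}" "knapsack R j" j] i knap j wgt_knapsack_le[OF R j]
        by (auto simp: wgt_def)
      then have "1 - 2 * \<epsilon>\<^sup>2 \<le> ER T p (\<lambda>Y. of_bool (rich j k Y))"
        using ER_rich[of i j] i knap j by auto
      moreover have "lost R j k \<subseteq> E" using knap by (auto simp: lost_def)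
      ultimately show ?thesis
        using val_nonneg[of "lost R j k" j] j by (intro mult_right_mono) (auto simp: add_nonneg_nonneg)
    qed (simp add: val_def)
    have "(1 - 3 * \<epsilon>\<^sup>2) * (1 + \<epsilon>\<^sup>2) \<le> 1 - 2 * \<epsilon>\<^sup>2"
      by (simp add: algebra_simps)
    then have "1 - 3 * \<epsilon>\<^sup>2 \<le> (1 - 2 * \<epsilon>\<^sup>2) / (1 + \<epsilon>\<^sup>2)"
      by (simp add: le_divide_eq add_pos_nonneg)
    then have "(1 - 3 * \<epsilon>\<^sup>2) * b \<le> (1 - 2 * \<epsilon>\<^sup>2) / (1 + \<epsilon>\<^sup>2) * b"
      using nonneg by (intro mult_right_mono)
    moreover have "(1 - 3 * \<epsilon>\<^sup>2) * (a + l) \<le> 1 * (a + l)"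
      using nonneg by (intro mult_right_mono) auto
    ultimately have "retained R j \<le> a + (1 - 2 * \<epsilon>\<^sup>2) / (1 + \<epsilon>\<^sup>2) * b - \<epsilon>\<^sup>2 * M j"
      using False by (simp add: retained_def total l_def[symmetric] distrib_left)
    also have "(1 - 2 * \<epsilon>\<^sup>2) / (1 + \<epsilon>\<^sup>2) * b =
        (\<Sum>k\<le>bucketK \<epsilon>. (1 - 2 * \<epsilon>\<^sup>2) * (val j (lost R j k) / (1 + \<epsilon>\<^sup>2)))"
      unfolding b_def val_def sum_lost[OF R j False, symmetric]
      by (simp add: sum_distrib_left sum_divide_distrib)
    also have "a + \<dots> - \<epsilon>\<^sup>2 * M j \<le>
        a + (\<Sum>k\<le>bucketK \<epsilon>. ER T p (\<lambda>Y. of_bool (rich j k Y)) * (val j (lost R j k) / (1 + \<epsilon>\<^sup>2))) - \<epsilon>\<^sup>2 * M j"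
      using sum_mono[of "{..bucketK \<epsilon>}", OF each] by simp
    also have "\<dots> = ER T p (\<lambda>Y. knapsack_bound R (X \<union> Y) j)"
      using False by (simp only: knapsack_bound_def rich a_def if_False ER_add ER_diff ER_sum
          ER_const[OF finT] ER_cmult_right)
    finally show ?thesis .
  qed
qed

text \<open>The items of T are resampled: the optimum is taken with respect to X \<union> Y, where
  Y \<subseteq> T, while the replacements come from a copy Y' of Y that is independent of it.\<close>

lemma ER_restricted_opt_ge_retained:
  "ER E p (\<lambda>R. \<Sum>j<m. retained R j) \<le> ER E p (\<lambda>R. restricted_opt E m C v w (Q \<inter> R))"
proof -
  have fin: "finite T" "finite (E - T)" using T_sub finite_E finite_subset by blast+
  have E: "E = (E - T) \<union> T" using T_sub by blast
  have split: "ER E p h = ER (E - T) p (\<lambda>X. ER T p (\<lambda>Y. h (X \<union> Y)))" for h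
    by (subst E, rule ER_Un) (use fin in auto)
  have "(\<Sum>j<m. retained (X \<union> Y) j) \<le> ER T p (\<lambda>Y'. restricted_opt E m C v w (Q \<inter> (X \<union> Y')))"
    if X: "X \<subseteq> E - T" and Y: "Y \<subseteq> T" for X Y
  proof -
    have XY: "X \<union> Y \<subseteq> E" "X \<inter> T = {}" using X Y T_sub by blast+
    have "(\<Sum>j<m. retained (X \<union> Y) j) \<le> (\<Sum>j<m. ER T p (\<lambda>Y'. knapsack_bound (X \<union> Y) (X \<union> Y') j))"
      by (intro sum_mono ER_knapsack_bound XY) simp
    also have "\<dots> = ER T p (\<lambda>Y'. \<Sum>j<m. knapsack_bound (X \<union> Y) (X \<union> Y') j)"
      by (simp add: ER_sum)
    also have "\<dots> \<le> ER T p (\<lambda>Y'. restricted_opt E m C v w (Q \<inter> (X \<union> Y')))"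
    proof (rule ER_mono)
      fix Y' assume "Y' \<subseteq> T"
      then show "(\<Sum>j<m. knapsack_bound (X \<union> Y) (X \<union> Y') j) \<le> restricted_opt E m C v w (Q \<inter> (X \<union> Y'))"
        using X Y T_sub by (intro restricted_opt_ge_bound) blast+
    qed (use p in auto)
    finally show ?thesis .
  qed
  then have inner: "ER T p (\<lambda>Y. \<Sum>j<m. retained (X \<union> Y) j) \<le>
      ER T p (\<lambda>_. ER T p (\<lambda>Y'. restricted_opt E m C v w (Q \<inter> (X \<union> Y'))))"
    if "X \<subseteq> E - T" for X
    using p that by (intro ER_mono) auto
  show ?thesis
    unfolding split[of "\<lambda>R. \<Sum>j<m. retained R j"] split[of "\<lambda>R. restricted_opt E m C v w (Q \<inter> R)"]
  proof (rule ER_mono)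
    show "ER T p (\<lambda>Y. \<Sum>j<m. retained (X \<union> Y) j) \<le> ER T p (\<lambda>Y. restricted_opt E m C v w (Q \<inter> (X \<union> Y)))"
      if "X \<subseteq> E - T" for X
      \<comment> \<open>The right side of \<open>inner\<close> is free of \<open>Y\<close>, so
        averaging over \<open>Y\<close> leaves it unchanged.\<close>
      using inner[OF that] by (simp only: ER_const[OF fin(1)])
  qed (use p in auto)
qed

text \<open>In expectation the additive loss of bucket 0 is another \<epsilon>^2 share of
  \<open>M j\<close>, which raises 3 \<epsilon>^2 to 4 \<epsilon>^2; a knapsack with open top
  retains all of \<open>M j\<close>.\<close>

lemma ER_restricted_opt_ge:
  "(1 - 4 * \<epsilon>\<^sup>2) * (\<Sum>j<m. M j) - ER E p (\<lambda>R. \<Sum>j<m. val j (knapsack R j \<inter> T))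
     \<le> ER E p (\<lambda>R. restricted_opt E m C v w (Q \<inter> R))"
proof -
  have "(1 - 4 * \<epsilon>\<^sup>2) * M j - ER E p (\<lambda>R. val j (knapsack R j \<inter> T)) \<le> ER E p (\<lambda>R. retained R j)"
    if j: "j < m" for j
  proof (cases "open_top j")
    case True
    have "ER E p (\<lambda>_. 0) \<le> ER E p (\<lambda>R. val j (knapsack R j \<inter> T))"
    proof (rule ER_mono)
      fix R assume "R \<subseteq> E"
      then show "0 \<le> val j (knapsack R j \<inter> T)"
        using T_sub j by (intro val_nonneg) auto
    qed (use p in auto)
    moreover have "(1 - 4 * \<epsilon>\<^sup>2) * M j \<le> 1 * M j"
      using M_nonneg[OF j] by (intro mult_right_mono) auto
    ultimately show ?thesis
      using True by (simp add: retained_def ER_const[OF finite_E])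
  next
    case False
    then have "ER E p (\<lambda>R. retained R j) =
        (1 - 3 * \<epsilon>\<^sup>2) * M j - ER E p (\<lambda>R. val j (knapsack R j \<inter> T)) - \<epsilon>\<^sup>2 * M j"
      by (simp only: retained_def if_False ER_diff ER_cmult ER_const[OF finite_E] M_val[symmetric])
    then show ?thesis by (simp add: algebra_simps)
  qed
  then have "(\<Sum>j<m. (1 - 4 * \<epsilon>\<^sup>2) * M j - ER E p (\<lambda>R. val j (knapsack R j \<inter> T))) \<le>
      (\<Sum>j<m. ER E p (\<lambda>R. retained R j))"
    by (intro sum_mono) simp
  then have "(1 - 4 * \<epsilon>\<^sup>2) * (\<Sum>j<m. M j) - ER E p (\<lambda>R. \<Sum>j<m. val j (knapsack R j \<inter> T)) \<le>
      ER E p (\<lambda>R. \<Sum>j<m. retained R j)"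
    by (simp add: sum_subtractf sum_distrib_left ER_sum)
  then show ?thesis
    using ER_restricted_opt_ge_retained by linarith
qed

end

section \<open>All rounds together\<close>

text \<open>The floor and the subtracted 1 cost at most 2 rounds, and 1 / \<epsilon> - 2 is at least
  two thirds of 1 / \<epsilon> because 1 / \<epsilon> > 6.\<close>

lemma num_rounds_bounds:
  assumes "0 < \<epsilon>" "\<epsilon> < 1 / 6"
  shows "0 < num_rounds \<epsilon>" "1 / real (num_rounds \<epsilon>) \<le> 3 / 2 * \<epsilon>" "real (num_rounds \<epsilon>) \<le> 1 / \<epsilon>"
proof -
  have "6 < 1 / \<epsilon>" using assms by (simp add: field_simps)
  then have n: "0 < num_rounds \<epsilon>" "1 / \<epsilon> - 2 \<le> real (num_rounds \<epsilon>)" "real (num_rounds \<epsilon>) \<le> 1 / \<epsilon>"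
    unfolding num_rounds_def by linarith+
  have "1 \<le> 3 / 2 * \<epsilon> * (1 / \<epsilon> - 2)"
    using assms by (simp add: algebra_simps)
  also have "\<dots> \<le> 3 / 2 * \<epsilon> * real (num_rounds \<epsilon>)"
    using assms n by (intro mult_left_mono) auto
  finally show "1 / real (num_rounds \<epsilon>) \<le> 3 / 2 * \<epsilon>"
    using n by (simp add: divide_le_eq)
  show "0 < num_rounds \<epsilon>" "real (num_rounds \<epsilon>) \<le> 1 / \<epsilon>" using n by auto
qed

text \<open>Lets \<open>degree_bound\<close> absorb additive constants into the logarithm.\<close>

lemma ln_inverse_ge_1:
  fixes \<epsilon> :: real
  assumes "0 < \<epsilon>" "\<epsilon> < 1 / 6"
  shows "1 \<le> ln (1 / \<epsilon>)"
proof -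
  have "exp 1 \<le> 1 / \<epsilon>"
    using assms by (intro order_trans[OF exp_le]) (simp add: field_simps)
  then show ?thesis
    using assms by (simp add: ln_ge_iff)
qed

text \<open>The constant is 127 = 2 * (9 * 7) + 1, with 9 from the number of buckets and 7 from the
  budget including its overshoot.\<close>

lemma degree_bound:
  assumes \<epsilon>: "0 < \<epsilon>" "\<epsilon> < 1 / 6" and p: "0 < p" "p \<le> 1"
  shows "2 * (real (num_rounds \<epsilon>) * (real (bucketK \<epsilon> + 2) * (tau (\<epsilon>\<^sup>2) / p + 1))) + 1
    \<le> 127 * (ln (1 / \<epsilon>))\<^sup>2 / (\<epsilon> ^ 3 * p)"
proof -
  define L where "L = ln (1 / \<epsilon>)"
  have L: "1 \<le> L" unfolding L_def by (rule ln_inverse_ge_1[OF \<epsilon>])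
  have ln2: "ln (1 / \<epsilon>\<^sup>2) = 2 * L" and ln3: "ln (1 / \<epsilon> ^ 3) = 3 * L"
    using \<epsilon> by (simp_all add: L_def ln_div ln_realpow)
  \<comment> \<open>The radicand is below the square of 2 L + 1, so \<open>tau\<close> is at most 4
    L + 2.\<close>
  have "sqrt ((2 * L)\<^sup>2 + 2 * (2 * L)) \<le> 2 * L + 1"
    using L by (intro real_le_lsqrt) (simp_all add: power2_eq_square algebra_simps)
  then have tau: "tau (\<epsilon>\<^sup>2) \<le> 6 * L"
    using L by (simp add: tau_def ln2)
  have "tau (\<epsilon>\<^sup>2) / p + 1 \<le> 6 * L / p + L / p"
    using tau p L by (intro add_mono divide_right_mono) (auto simp: le_divide_eq intro: order_trans[of p 1 L])
  then have budget: "tau (\<epsilon>\<^sup>2) / p + 1 \<le> 7 * L / p"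
    by (simp add: add_divide_distrib[symmetric])
  have eps2: "\<epsilon>\<^sup>2 \<le> 1" using \<epsilon> by (simp add: power_le_one)
  have "0 \<le> (2 / \<epsilon>\<^sup>2) * (3 * L)" using L by simp
  \<comment> \<open>The 3 consists of the two extra buckets and 1 for the ceiling.\<close>
  then have "real (bucketK \<epsilon> + 2) \<le> (2 / \<epsilon>\<^sup>2) * (3 * L) + 3"
    unfolding bucketK_def ln3 by linarith
  moreover have "3 \<le> 3 * L / \<epsilon>\<^sup>2"
    using L eps2 \<epsilon> by (simp add: le_divide_eq)
  moreover have "(2 / \<epsilon>\<^sup>2) * (3 * L) + 3 * L / \<epsilon>\<^sup>2 = 9 * L / \<epsilon>\<^sup>2"
    by (simp add: add_divide_distrib[symmetric])
  ultimately have buckets: "real (bucketK \<epsilon> + 2) \<le> 9 * L / \<epsilon>\<^sup>2"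
    by linarith
  have tau0: "0 \<le> tau (\<epsilon>\<^sup>2) / p + 1"
    using p L by (simp add: tau_def ln2)
  have "real (num_rounds \<epsilon>) * (real (bucketK \<epsilon> + 2) * (tau (\<epsilon>\<^sup>2) / p + 1)) \<le>
      1 / \<epsilon> * (9 * L / \<epsilon>\<^sup>2 * (7 * L / p))"
    using num_rounds_bounds[OF \<epsilon>] buckets budget tau0 L p \<epsilon> by (intro mult_mono) auto
  also have "\<dots> = 63 * (L\<^sup>2 / (\<epsilon> ^ 3 * p))"
    by (simp add: power2_eq_square power3_eq_cube)
  finally have D: "real (num_rounds \<epsilon>) * (real (bucketK \<epsilon> + 2) * (tau (\<epsilon>\<^sup>2) / p + 1)) \<le>
      63 * (L\<^sup>2 / (\<epsilon> ^ 3 * p))" .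
  have "\<epsilon> ^ 3 * p \<le> 1 * 1"
    using \<epsilon> p by (intro mult_mono) (auto simp: power_le_one)
  also have "1 * 1 \<le> L\<^sup>2" using L by simp
  finally have "1 \<le> L\<^sup>2 / (\<epsilon> ^ 3 * p)"
    using \<epsilon> p by (simp add: le_divide_eq)
  then show ?thesis
    using D unfolding L_def[symmetric] by simp
qed

context gap_opt
begin

lemma tau_nonneg: "0 \<le> tau (\<epsilon>\<^sup>2)"
proof -
  have "0 \<le> 2 * ln (1 / \<epsilon>\<^sup>2)" using \<epsilon> by (simp add: power_le_one)
  also have "\<dots> \<le> tau (\<epsilon>\<^sup>2)" using \<epsilon> by (intro tau_ge) (auto simp: power_le_one)
  finally show ?thesis .
qed

text \<open>Rounds query disjoint sets, so their charging maps can be glued together and their loads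
  add up.\<close>

lemma rounds_load:
  assumes "(sparsifier_round E m C v w \<epsilon> p M ^^ n) {} Q"
  shows "Q \<subseteq> E \<and> (\<exists>g. (\<forall>i\<in>Q. g i < m \<and> w i (g i) \<le> C (g i)) \<and>
    (\<forall>j<m. (\<Sum>i\<in>{i\<in>Q. g i = j}. w i j)
        \<le> real n * (real (bucketK \<epsilon> + 2) * (tau (\<epsilon>\<^sup>2) / p + 1)) * C j))"
  using assms
proof (induction n arbitrary: Q)
  case 0
  then show ?case by simp
next
  case (Suc n)
  then obtain Q' where Q': "(sparsifier_round E m C v w \<epsilon> p M ^^ n) {} Q'"
    and round: "sparsifier_round E m C v w \<epsilon> p M Q' Q"
    by (auto elim: relpowp_Suc_E)
  define \<beta> where "\<beta> = tau (\<epsilon>\<^sup>2) / p"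
  obtain g where g: "\<And>i. i \<in> Q' \<Longrightarrow> g i < m \<and> w i (g i) \<le> C (g i)"
    "\<And>j. j < m \<Longrightarrow> (\<Sum>i\<in>{i\<in>Q'. g i = j}. w i j) \<le> real n * (real (bucketK \<epsilon> + 2) * (\<beta> + 1)) * C j"
    and "Q' \<subseteq> E"
    using Suc.IH[OF Q'] unfolding \<beta>_def by blast
  obtain h where h: "saturating \<beta> Q' Q h"
    using sparsifier_round_saturating[OF p(1) tau_nonneg round] unfolding \<beta>_def by blast
  then have sub: "Q' \<subseteq> Q" "Q \<subseteq> E"
    using \<open>Q' \<subseteq> E\<close> by (auto simp: saturating_def)
  define g' where "g' i = (if i \<in> Q' then g i else h i)" for i
  have "g' i < m \<and> w i (g' i) \<le> C (g' i)" if "i \<in> Q" for i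
    using that g(1) h by (auto simp: g'_def saturating_def)
  moreover have "(\<Sum>i\<in>{i\<in>Q. g' i = j}. w i j) \<le> real (Suc n) * (real (bucketK \<epsilon> + 2) * (\<beta> + 1)) * C j"
    if j: "j < m" for j
  proof -
    have "{i\<in>Q. g' i = j} = {i\<in>Q'. g i = j} \<union> {i\<in>Q - Q'. h i = j}"
      using sub by (auto simp: g'_def)
    moreover have "finite Q" using sub finite_E finite_subset by blast
    ultimately have "(\<Sum>i\<in>{i\<in>Q. g' i = j}. w i j) =
        (\<Sum>i\<in>{i\<in>Q'. g i = j}. w i j) + (\<Sum>i\<in>{i\<in>Q - Q'. h i = j}. w i j)"
      using sub finite_subset[OF sub(1)] by (simp add: sum.union_disjoint disjoint_iff)
    also have "\<dots> \<le> real n * (real (bucketK \<epsilon> + 2) * (\<beta> + 1)) * C j + real (bucketK \<epsilon> + 2) * ((\<beta> + 1) * C j)"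
      by (intro add_mono g(2) saturating_load[OF h] j)
    also have "\<dots> = real (Suc n) * (real (bucketK \<epsilon> + 2) * (\<beta> + 1)) * C j"
      by (simp add: algebra_simps)
    finally show ?thesis .
  qed
  ultimately show ?case
    using sub(2) unfolding \<beta>_def by blast
qed

text \<open>The parts of the optimum queried in different rounds are disjoint, so some round
  carries at most an average share of its value.\<close>

lemma sparsifier_value:
  assumes "sparsifier_output E m C v w \<epsilon> p M Q"
  shows "(1 - 6 * \<epsilon>) * ER E p (gap_f E m C v w) \<le> ER E p (\<lambda>R. restricted_opt E m C v w (Q \<inter> R))"
proof -
  define n where "n = num_rounds \<epsilon>"
  note n = num_rounds_bounds[OF \<epsilon>, folded n_def]
  have "(sparsifier_round E m C v w \<epsilon> p M ^^ n) {} Q"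
    using assms by (simp add: sparsifier_output_def n_def)
  \<comment> \<open>\<open>f t\<close> is the query set after \<open>t\<close> rounds.\<close>
  then obtain f where f: "f 0 = {}" "f n = Q" "\<And>t. t < n \<Longrightarrow> sparsifier_round E m C v w \<epsilon> p M (f t) (f (Suc t))"
    unfolding relpowp_fun_conv by blast
  have sat: "\<exists>g. saturating (tau (\<epsilon>\<^sup>2) / p) (f t) (f (Suc t)) g" if "t < n" for t
    by (rule sparsifier_round_saturating[OF p(1) tau_nonneg f(3)[OF that]])
  have f_Suc: "f t \<subseteq> f (Suc t)" "f (Suc t) \<subseteq> E \<union> f t" if "t < n" for t
    using sat[OF that] by (auto simp: saturating_def)
  have f_E: "f t \<subseteq> E" if "t \<le> n" for t
    using that
  proof (induction t)
    case (Suc t)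
    then show ?case using f_Suc(2)[of t] by auto
  qed (simp add: f)
  have f_Q: "f t \<subseteq> Q" if "t \<le> n" for t
    using that
  proof (induction t rule: inc_induct)
    case (step t)
    then show ?case using f_Suc(1)[of t] by blast
  qed (simp add: f)
  define S where "S = (\<Sum>j<m. M j)"
  define loss where "loss t = ER E p (\<lambda>R. \<Sum>j<m. val j (knapsack R j \<inter> (f (Suc t) - f t)))" for t
  have "(\<Sum>t<n. \<Sum>j<m. val j (knapsack R j \<inter> (f (Suc t) - f t))) \<le> (\<Sum>j<m. val j (knapsack R j))"
    if R: "R \<subseteq> E" for R
  proof -
    have knap: "knapsack R j \<subseteq> E" "finite (knapsack R j)" for j
      by (rule knapsack_E[OF R])+
    have "(\<Sum>t<n. val j (knapsack R j \<inter> (f (Suc t) - f t))) \<le> val j (knapsack R j)" if "j < m" for j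
    proof -
      \<comment> \<open>Since the sets \<open>f t\<close> are nested, the share of each round is a
        difference and the sum telescopes to the share of \<open>Q\<close>.\<close>
      have "val j (knapsack R j \<inter> (f (Suc t) - f t)) = val j (knapsack R j \<inter> f (Suc t)) - val j (knapsack R j \<inter> f t)"
        if "t < n" for t
      proof -
        have "knapsack R j \<inter> (f (Suc t) - f t) = (knapsack R j \<inter> f (Suc t)) - (knapsack R j \<inter> f t)"
          by blast
        moreover have "val j ((knapsack R j \<inter> f (Suc t)) - (knapsack R j \<inter> f t)) =
            val j (knapsack R j \<inter> f (Suc t)) - val j (knapsack R j \<inter> f t)"
          unfolding val_def using f_Suc(1)[OF that] knap by (intro sum_diff) auto
        ultimately show ?thesis by (simp only:)
      qed
      then have "(\<Sum>t<n. val j (knapsack R j \<inter> (f (Suc t) - f t))) =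
          (\<Sum>t<n. val j (knapsack R j \<inter> f (Suc t)) - val j (knapsack R j \<inter> f t))"
        by (intro sum.cong) auto
      also have "\<dots> = val j (knapsack R j \<inter> Q)"
        using sum_lessThan_telescope[of "\<lambda>t. val j (knapsack R j \<inter> f t)" n] by (simp add: f val_def)
      also have "\<dots> \<le> val j (knapsack R j)"
        unfolding val_def using knap(2) v_nonneg[OF subsetD[OF knap(1)] \<open>j < m\<close>]
        by (intro sum_mono2) auto
      finally show ?thesis .
    qed
    then have "(\<Sum>j<m. \<Sum>t<n. val j (knapsack R j \<inter> (f (Suc t) - f t))) \<le> (\<Sum>j<m. val j (knapsack R j))"
      by (intro sum_mono) simp
    then show ?thesis by (subst sum.swap)
  qed
  then have "(\<Sum>t<n. loss t) \<le> ER E p (\<lambda>R. \<Sum>j<m. val j (knapsack R j))"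
    unfolding loss_def ER_sum[symmetric] using p by (intro ER_mono) auto
  also have "\<dots> = S"
    by (simp only: ER_sum M_val[symmetric] S_def)
  finally have sum_loss: "(\<Sum>t<n. loss t) \<le> S" .
  have "\<exists>t<n. loss t \<le> S / n"
  proof (rule ccontr)
    assume "\<not> ?thesis"
    then have "(\<Sum>t<n. S / n) < (\<Sum>t<n. loss t)"
      using n(1) by (intro sum_strict_mono) (auto simp: not_le)
    then show False using n(1) sum_loss by simp
  qed
  then obtain t where t: "t < n" "loss t \<le> S / n" by blast
  obtain g where g: "saturating (tau (\<epsilon>\<^sup>2) / p) (f t) (f (Suc t)) g"
    using sat[OF t(1)] by blast
  interpret gap_round E m C v w \<epsilon> M p opt "f t" "f (Suc t)" Q g
    by unfold_locales (use g f_Q[of "Suc t"] f_E[of n] f t in auto)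
  have "0 \<le> S" unfolding S_def by (intro sum_nonneg M_nonneg) simp
  \<comment> \<open>The total loss is at most (3/2 + 2/3) \<epsilon> \<open>S\<close>, well within 6
    \<epsilon> \<open>S\<close>.\<close>
  have "S / n \<le> 3 / 2 * \<epsilon> * S"
    using mult_right_mono[OF n(2) \<open>0 \<le> S\<close>] by simp
  moreover have "4 * \<epsilon>\<^sup>2 * S \<le> 4 * (\<epsilon> / 6) * S"
    using eps_sq \<open>0 \<le> S\<close> by (intro mult_right_mono) auto
  moreover have "0 \<le> \<epsilon> * S" using \<open>0 \<le> S\<close> \<epsilon> by simp
  ultimately have "(1 - 6 * \<epsilon>) * S \<le> (1 - 4 * \<epsilon>\<^sup>2) * S - loss t"
    using t(2) by (simp add: algebra_simps)
  then show ?thesis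
    using ER_restricted_opt_ge unfolding S_def[symmetric] loss_def ER_gap_f by linarith
qed

lemma sparsifier_output_approx:
  assumes "sparsifier_output E m C v w \<epsilon> p M Q"
  shows "approx_sparsifier E m C v w p (1 - 6 * \<epsilon>) (127 * (ln (1 / \<epsilon>))\<^sup>2 / (\<epsilon> ^ 3 * p)) Q"
proof -
  define D where "D = real (num_rounds \<epsilon>) * (real (bucketK \<epsilon> + 2) * (tau (\<epsilon>\<^sup>2) / p + 1))"
  have D: "0 \<le> D"
    using tau_nonneg p by (simp add: D_def)
  have deg: "2 * D + 1 \<le> 127 * (ln (1 / \<epsilon>))\<^sup>2 / (\<epsilon> ^ 3 * p)"
    unfolding D_def by (rule degree_bound[OF \<epsilon> p])
  obtain g where "Q \<subseteq> E" and g: "\<And>i. i \<in> Q \<Longrightarrow> g i < m \<and> w i (g i) \<le> C (g i)"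
    "\<And>j. j < m \<Longrightarrow> (\<Sum>i\<in>{i\<in>Q. g i = j}. w i j) \<le> D * C j"
    using rounds_load[of "num_rounds \<epsilon>" Q] assms unfolding sparsifier_output_def D_def by blast
  show ?thesis
    unfolding approx_sparsifier_def
    using \<open>Q \<subseteq> E\<close> D deg in_PF_of_load[OF gap_inst \<open>Q \<subseteq> E\<close> g D deg] sparsifier_value[OF assms]
    by (simp add: restricted_opt_def)
qed

end

theorem theorem2:
  shows "\<exists>c>0. \<forall>(E :: 'a set) m C v w \<epsilon> p opt Q.
     gap_instance E m C v w \<longrightarrow> 0 < \<epsilon> \<longrightarrow> \<epsilon> < 1/6 \<longrightarrow> 0 < p \<longrightarrow> p \<le> 1 \<longrightarrow>
     opt_rule E m C v w opt \<longrightarrow>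
     sparsifier_output E m C v w \<epsilon> p
        (\<lambda>j. ER E p (\<lambda>R. assign_value_in v (opt R) j)) Q \<longrightarrow>
     approx_sparsifier E m C v w p (1 - 6 * \<epsilon>)
        (c * (ln (1 / \<epsilon>))\<^sup>2 / (\<epsilon> ^ 3 * p)) Q"
proof (intro exI[of _ "127::real"] conjI allI impI)
  fix E :: "'a set" and m C and v w :: "'a \<Rightarrow> nat \<Rightarrow> real" and \<epsilon> p opt Q
  let ?M = "\<lambda>j. ER E p (\<lambda>R. assign_value_in v (opt R) j)"
  assume "gap_instance E m C v w" "0 < \<epsilon>" "\<epsilon> < 1/6" "0 < p" "p \<le> 1"
    "opt_rule E m C v w opt" and out: "sparsifier_output E m C v w \<epsilon> p ?M Q"
  then interpret gap_opt E m C v w \<epsilon> ?M p opt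
    by unfold_locales auto
  show "approx_sparsifier E m C v w p (1 - 6 * \<epsilon>) (127 * (ln (1 / \<epsilon>))\<^sup>2 / (\<epsilon> ^ 3 * p)) Q"
    by (rule sparsifier_output_approx[OF out])
qed simp

end
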